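(* Let $(r_1,r_2,\dots)$ be a sequence of nonnegative real numbers with $\sum_i r_i=1$. There exists $\Phi\in\mathrm{End}(\mathcal{Q})$ such that for every $n$ and every $\pi\in\mathfrak{S}_n$, $\mathrm{Prob}_\Phi(\pi)=\mathrm{Prob}_{QS}(\pi^{-1})$. Equivalently, the matrix $K$ associated with $\Phi$ satisfies $K(\pi,\sigma\pi)=\mathrm{Prob}_{QS}(\sigma)$ for all $\sigma,\pi\in\mathfrak{S}_n$.
   Context: Work over $\mathbb{R}$. Compositions $\alpha=(a_1,\dots,a_k)$ of $n$, $\operatorname{Comp}(n)$, $(n)$ the one-part composition, $S_\alpha=\{a_1,\dots,a_1+\dots+a_{k-1}\}$, $\operatorname{co}$ its inverse, $\alpha\le\beta$ iff $S_\alpha\subseteq S_\beta$. $M_\alpha=\sum_{i_1<\dots<i_k}x_{i_1}^{a_1}\cdots x_{i_k}^{a_k}$; $\mathcal{Q}=\bigoplus_n\mathcal{Q}_n$ the graded Hopf algebra of quasisymmetric functions (coproduct $\Delta(M_\alpha)=\sum_{\alpha=\beta\cdot\gamma}M_\beta\otimes M_\gamma$); $F_\alpha=\sum_{\beta\ge\alpha}M_\beta$. $\mathrm{End}(\mathcal{Q})$ = graded Hopf algebra endomorphisms. For $\sigma\in\mathfrak{S}_n$, $D(\sigma)=\operatorname{co}(\{i:\sigma_i>\sigma_{i+1}\})$; product in $\mathfrak{S}_n$ is composition. For $\Phi\in\mathrm{End}(\mathcal{Q})$ define $c_{\alpha,\beta}$ by $\Phi(F_\alpha)=\sum_\beta c_{\alpha,\beta}F_\beta$;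 when the $c_{\alpha,(n)}$ are nonnegative and not all zero, $\mathrm{Prob}_\Phi(\pi)=c_{D(\pi),(n)}/\sum_{\sigma\in\mathfrak{S}_n}c_{D(\sigma),(n)}$ and $K(\pi,\sigma\pi)=\mathrm{Prob}_\Phi(\sigma^{-1})$. The $QS$-distribution on $\mathfrak{S}_n$ is $\mathrm{Prob}_{QS}(\pi)=F_{D(\pi^{-1})}(r_1,r_2,\dots)$. *)

theory Defs
  imports "HOL-Analysis.Analysis" "HOL-Library.Multiset" "HOL-Combinatorics.Permutations"
begin

section \<open>Formal power series in commuting variables\<close>

text \<open>A monomial in variables indexed by \<^typ>\<open>'v\<close> is the multiset of its variables, so an arbitrary
  function on multisets is a formal power series, and the product is the Cauchy product.\<close>

typedef 'v mseries = "UNIV :: ('v multiset \<Rightarrow> real) set"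
  morphisms mcoeff MSeries ..

setup_lifting type_definition_mseries

lemma mseries_eqI: "(\<And>m. mcoeff f m = mcoeff g m) \<Longrightarrow> f = g"
  by transfer auto

lemma mcoeff_MSeries [simp]: "mcoeff (MSeries c) = c"
  by (simp add: MSeries_inverse)

instantiation mseries :: (type) real_vector
begin
lift_definition zero_mseries :: "'v mseries" is "\<lambda>_. 0" .
lift_definition plus_mseries :: "'v mseries \<Rightarrow> 'v mseries \<Rightarrow> 'v mseries" is "\<lambda>f g m. f m + g m" .
lift_definition minus_mseries :: "'v mseries \<Rightarrow> 'v mseries \<Rightarrow> 'v mseries" is "\<lambda>f g m. f m - g m" .
lift_definition uminus_mseries :: "'v mseries \<Rightarrow> 'v mseries" is "\<lambda>f m. - f m" .
lift_definition scaleR_mseries :: "real \<Rightarrow> 'v mseries \<Rightarrow> 'v mseries" is "\<lambda>c f m. c * f m" .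
instance
  by standard (transfer; simp add: algebra_simps fun_eq_iff)+
end

lemma mcoeff_zero [simp]: "mcoeff 0 m = 0" by transfer simp
lemma mcoeff_plus [simp]: "mcoeff (f + g) m = mcoeff f m + mcoeff g m" by transfer simp
lemma mcoeff_minus [simp]: "mcoeff (f - g) m = mcoeff f m - mcoeff g m" by transfer simp
lemma mcoeff_uminus [simp]: "mcoeff (- f) m = - mcoeff f m" by transfer simp
lemma mcoeff_scaleR [simp]: "mcoeff (c *\<^sub>R f) m = c * mcoeff f m" by transfer simp
lemma mcoeff_sum [simp]: "mcoeff (sum f A) m = (\<Sum>x\<in>A. mcoeff (f x) m)"
  by (induction A rule: infinite_finite_induct) auto

lemma finite_submultisets: "finite {a. a \<subseteq># (m :: 'v multiset)}"
proof (induction m)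
  case (add x m)
  have "{a. a \<subseteq># add_mset x m} \<subseteq> {a. a \<subseteq># m} \<union> add_mset x ` {a. a \<subseteq># m}"
  proof
    fix a assume "a \<in> {a. a \<subseteq># add_mset x m}"
    then have a: "a \<subseteq># add_mset x m" by simp
    show "a \<in> {a. a \<subseteq># m} \<union> add_mset x ` {a. a \<subseteq># m}"
    proof (cases "x \<in># a")
      case True
      then obtain b where "a = add_mset x b" by (metis insert_DiffM)
      then show ?thesis using a by auto
    next
      case False
      then have "a \<subseteq># m"
        using a by (metis add_mset_remove_trivial diff_single_trivial subset_eq_diff_conv
            add_mset_add_single)
      then show ?thesis by simp
    qed
  qed
  then show ?case using add by (meson finite_UnI finite_imageI finite_subset)
qed auto

instantiation mseries :: (type) comm_ring_1
begin
lift_definition one_mseries :: "'v mseries" is "\<lambda>m. of_bool (m = {#})" .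
lift_definition times_mseries :: "'v mseries \<Rightarrow> 'v mseries \<Rightarrow> 'v mseries"
  is "\<lambda>f g m. \<Sum>a\<in>{a. a \<subseteq># m}. f a * g (m - a)" .
instance
proof
  fix f g h :: "'v mseries"
  show "f * g = g * f"
  proof (transfer, rule ext)
    fix f g :: "'v multiset \<Rightarrow> real" and m
    show "(\<Sum>a\<in>{a. a \<subseteq># m}. f a * g (m - a)) = (\<Sum>a\<in>{a. a \<subseteq># m}. g a * f (m - a))"
      by (rule sum.reindex_bij_witness[of _ "\<lambda>a. m - a" "\<lambda>a. m - a"])
        (auto simp: mult.commute subset_mset.diff_diff_right)
  qed
  show "f * g * h = f * (g * h)"
  proof (transfer, rule ext)
    fix f g h :: "'v multiset \<Rightarrow> real" and m
    have "(\<Sum>a\<in>{a. a \<subseteq># m}. (\<Sum>b\<in>{b. b \<subseteq># a}. f b * g (a - b)) * h (m - a)) =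
      (\<Sum>(a,b)\<in>(SIGMA a:{a. a \<subseteq># m}. {b. b \<subseteq># a}). f b * g (a - b) * h (m - a))"
      by (subst sum.Sigma[symmetric]) (auto simp: finite_submultisets sum_distrib_right)
    also have "\<dots> = (\<Sum>(b,c)\<in>(SIGMA b:{b. b \<subseteq># m}. {c. c \<subseteq># m - b}). f b * (g c * h (m - b - c)))"
    proof (rule sum.reindex_bij_witness[of _ "\<lambda>(b,c). (b + c, b)" "\<lambda>(a,b). (b, a - b)"], goal_cases)
      case (1 x) then show ?case by auto
    next
      case (2 x) then show ?case
        by (auto simp: subset_mset.le_diff_conv2 intro: subset_mset.order_trans)
    next
      case (3 x) then show ?case by auto
    next
      case (4 x)
      then show ?case
        by (auto simp: subset_mset.le_diff_conv2 add.commute)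
    next
      case (5 x) then show ?case
        by (auto simp: mult.assoc)
    qed
    also have "\<dots> = (\<Sum>b\<in>{b. b \<subseteq># m}. f b * (\<Sum>c\<in>{c. c \<subseteq># m - b}. g c * h (m - b - c)))"
      by (subst sum.Sigma[symmetric]) (auto simp: finite_submultisets sum_distrib_left)
    finally show "(\<Sum>a\<in>{a. a \<subseteq># m}. (\<Sum>b\<in>{b. b \<subseteq># a}. f b * g (a - b)) * h (m - a)) =
       (\<Sum>b\<in>{b. b \<subseteq># m}. f b * (\<Sum>c\<in>{c. c \<subseteq># m - b}. g c * h (m - b - c)))" .
  qed
  show "1 * f = f"
  proof (transfer, rule ext)
    fix f :: "'v multiset \<Rightarrow> real" and m
    have "(\<Sum>a\<in>{a. a \<subseteq># m}. of_bool (a = {#}) * f (m - a)) =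
      (\<Sum>a\<in>{{#}}. of_bool (a = {#}) * f (m - a))"
      by (rule sum.mono_neutral_right) (auto simp: finite_submultisets)
    then show "(\<Sum>a\<in>{a. a \<subseteq># m}. of_bool (a = {#}) * f (m - a)) = f m" by simp
  qed
  show "(f + g) * h = f * h + g * h"
    by transfer (simp add: algebra_simps sum.distrib fun_eq_iff)
  show "(0 :: 'v mseries) \<noteq> 1"
    by transfer (auto simp: fun_eq_iff)
qed
end

instance mseries :: (type) real_algebra_1
proof
  fix f g :: "'v mseries" and c :: real
  show "c *\<^sub>R f * g = c *\<^sub>R (f * g)"
    by transfer (simp add: sum_distrib_left mult.assoc)
  show "f * c *\<^sub>R g = c *\<^sub>R (f * g)"
    by transfer (simp add: sum_distrib_left algebra_simps)
qed

text \<open>Substitution of the real numbers \<open>r i\<close> for the variables. The sum converges absolutely for a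
  quasisymmetric function \<open>f\<close> and a nonnegative summable \<open>r\<close>; it is \<open>0\<close> where it does not converge.\<close>

definition mseries_eval :: "'v mseries \<Rightarrow> ('v \<Rightarrow> real) \<Rightarrow> real" where
  "mseries_eval f r = (\<Sum>\<^sub>\<infinity>m. mcoeff f m * (\<Prod>i\<in>#m. r i))"


section \<open>Compositions\<close>

definition compositions :: "nat \<Rightarrow> nat list set" where
  "compositions n = {\<alpha>. 0 \<notin> set \<alpha> \<and> sum_list \<alpha> = n}"

definition all_compositions :: "nat list set" where
  "all_compositions = (\<Union>n. compositions n)"

text \<open>The composition \<open>(n)\<close>; for \<open>n = 0\<close> the only composition is the empty one.\<close>

definition one_part :: "nat \<Rightarrow> nat list" where
  "one_part n = (if n = 0 then [] else [n])"

definition partial_sums :: "nat list \<Rightarrow> nat set" where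
  "partial_sums \<alpha> = {sum_list (take j \<alpha>) | j. 1 \<le> j \<and> j < length \<alpha>}"

definition co :: "nat \<Rightarrow> nat set \<Rightarrow> nat list" where
  "co n = the_inv_into (compositions n) partial_sums"

definition comp_le :: "nat list \<Rightarrow> nat list \<Rightarrow> bool" where
  "comp_le \<alpha> \<beta> \<longleftrightarrow> sum_list \<alpha> = sum_list \<beta> \<and> partial_sums \<alpha> \<subseteq> partial_sums \<beta>"


section \<open>Quasisymmetric functions\<close>

text \<open>The variables are indexed by \<^typ>\<open>nat\<close>, starting at \<open>0\<close>. The coefficient of a monomial in
  \<open>M\<^sub>\<alpha>\<close> is the number of index sequences \<open>i\<^sub>1 < \<dots> < i\<^sub>k\<close> that produce it.\<close>

definition qs_M :: "nat list \<Rightarrow> nat mseries" where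
  "qs_M \<alpha> = MSeries (\<lambda>m. real (card {i. length i = length \<alpha> \<and> sorted_wrt (<) i \<and>
     (\<Sum>j<length \<alpha>. replicate_mset (\<alpha> ! j) (i ! j)) = m}))"

definition qs_F :: "nat list \<Rightarrow> nat mseries" where
  "qs_F \<alpha> = (\<Sum>\<beta> | \<beta> \<in> compositions (sum_list \<alpha>) \<and> comp_le \<alpha> \<beta>. qs_M \<beta>)"

definition QSym_deg :: "nat \<Rightarrow> nat mseries set" where
  "QSym_deg n = span (qs_M ` compositions n)"

definition QSym :: "nat mseries set" where
  "QSym = span (\<Union>n. QSym_deg n)"

text \<open>The tensor square of \<^const>\<open>QSym\<close> is realised by series in two alphabets (indexed by \<open>Inl\<close> and
  \<open>Inr\<close>): \<open>f \<otimes> g\<close> is \<open>f(x) g(y)\<close>, and \<open>QSym \<otimes> QSym\<close> is the span of these products. The canonical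
  map from the abstract tensor product to this span is injective.\<close>

definition tensor :: "'v mseries \<Rightarrow> 'w mseries \<Rightarrow> ('v + 'w) mseries" where
  "tensor f g = MSeries (\<lambda>m. mcoeff f (image_mset projl (filter_mset isl m)) *
     mcoeff g (image_mset projr (filter_mset (\<lambda>v. \<not> isl v) m)))"

text \<open>The linear extension of \<open>M\<^sub>\<alpha> \<mapsto> \<Sum> M\<^sub>\<beta> \<otimes> M\<^sub>\<gamma>\<close>, summed over the factorisations of \<open>\<alpha>\<close> as a
  concatenation of \<open>\<beta>\<close> and \<open>\<gamma>\<close>.\<close>

definition coproduct :: "nat mseries \<Rightarrow> (nat + nat) mseries" where
  "coproduct = construct (qs_M ` all_compositions)
     (\<lambda>b. \<Sum>(\<beta>, \<gamma>) | \<beta> @ \<gamma> = the_inv_into all_compositions qs_M b. tensor (qs_M \<beta>) (qs_M \<gamma>))"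

definition counit :: "nat mseries \<Rightarrow> real" where
  "counit f = mcoeff f {#}"

text \<open>Only the values on \<^const>\<open>QSym\<close> of an endomorphism matter. In the last conjunct \<open>T\<close> is
  \<open>\<Phi> \<otimes> \<Phi>\<close>, which is determined on \<open>QSym \<otimes> QSym\<close> by its values on pure tensors. As a bialgebra
  morphism between Hopf algebras automatically commutes with the antipodes, this
  is not listed as a separate condition.\<close>

definition hopf_endomorphisms :: "(nat mseries \<Rightarrow> nat mseries) set" where
  "hopf_endomorphisms = {\<Phi>.
     (\<forall>f\<in>QSym. \<forall>g\<in>QSym. \<Phi> (f + g) = \<Phi> f + \<Phi> g) \<and>
     (\<forall>c. \<forall>f\<in>QSym. \<Phi> (c *\<^sub>R f) = c *\<^sub>R \<Phi> f) \<and>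
     (\<forall>n. \<Phi> ` QSym_deg n \<subseteq> QSym_deg n) \<and>
     (\<forall>f\<in>QSym. \<forall>g\<in>QSym. \<Phi> (f * g) = \<Phi> f * \<Phi> g) \<and>
     \<Phi> 1 = 1 \<and>
     (\<forall>f\<in>QSym. counit (\<Phi> f) = counit f) \<and>
     (\<exists>T. linear T \<and> (\<forall>f\<in>QSym. \<forall>g\<in>QSym. T (tensor f g) = tensor (\<Phi> f) (\<Phi> g)) \<and>
        (\<forall>f\<in>QSym. coproduct (\<Phi> f) = T (coproduct f)))}"

text \<open>The number \<open>c\<^sub>\<alpha>\<^sub>,\<^sub>\<beta>\<close> with \<open>\<Phi> F\<^sub>\<alpha> = \<Sum> c\<^sub>\<alpha>\<^sub>,\<^sub>\<beta> F\<^sub>\<beta>\<close>.\<close>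

definition F_coeff :: "(nat mseries \<Rightarrow> nat mseries) \<Rightarrow> nat list \<Rightarrow> nat list \<Rightarrow> real" where
  "F_coeff \<Phi> \<alpha> \<beta> = representation (qs_F ` all_compositions) (\<Phi> (qs_F \<alpha>)) (qs_F \<beta>)"


section \<open>Probabilities on the symmetric group\<close>

text \<open>Elements of \<open>S\<^sub>n\<close> are the functions that permute \<open>{1..n}\<close>, with \<open>\<circ>\<close> as product.\<close>

definition descent_comp :: "nat \<Rightarrow> (nat \<Rightarrow> nat) \<Rightarrow> nat list" where
  "descent_comp n \<sigma> = co n {i. 1 \<le> i \<and> i < n \<and> \<sigma> i > \<sigma> (i + 1)}"

text \<open>The condition under which \<open>prob_endo\<close> and \<open>K_matrix\<close> are meaningful.\<close>

definition prob_defined :: "(nat mseries \<Rightarrow> nat mseries) \<Rightarrow> nat \<Rightarrow> bool" where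
  "prob_defined \<Phi> n \<longleftrightarrow> (\<forall>\<alpha>\<in>compositions n. F_coeff \<Phi> \<alpha> (one_part n) \<ge> 0) \<and>
     (\<exists>\<alpha>\<in>compositions n. F_coeff \<Phi> \<alpha> (one_part n) \<noteq> 0)"

definition prob_endo :: "(nat mseries \<Rightarrow> nat mseries) \<Rightarrow> nat \<Rightarrow> (nat \<Rightarrow> nat) \<Rightarrow> real" where
  "prob_endo \<Phi> n \<pi> = F_coeff \<Phi> (descent_comp n \<pi>) (one_part n) /
     (\<Sum>\<sigma> | \<sigma> permutes {1..n}. F_coeff \<Phi> (descent_comp n \<sigma>) (one_part n))"

text \<open>The entry at \<open>(\<pi>, \<sigma>\<pi>)\<close> is the probability of \<open>\<sigma>\<^sup>-\<^sup>1\<close>; here \<open>\<tau> = \<sigma>\<pi>\<close>.\<close>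

definition K_matrix ::
  "(nat mseries \<Rightarrow> nat mseries) \<Rightarrow> nat \<Rightarrow> (nat \<Rightarrow> nat) \<Rightarrow> (nat \<Rightarrow> nat) \<Rightarrow> real" where
  "K_matrix \<Phi> n \<pi> \<tau> = prob_endo \<Phi> n (inv (\<tau> \<circ> inv \<pi>))"

text \<open>The sequence \<open>r\<^sub>1, r\<^sub>2, \<dots>\<close> is \<open>r 0, r 1, \<dots>\<close>.\<close>

definition prob_QS :: "(nat \<Rightarrow> real) \<Rightarrow> nat \<Rightarrow> (nat \<Rightarrow> nat) \<Rightarrow> real" where
  "prob_QS r n \<pi> = mseries_eval (qs_F (descent_comp n (inv \<pi>))) r"

end

theory Submission
  imports Defs
begin

text \<open>The endomorphism is \<open>\<Phi> f(y) = f(r\<^sub>i y\<^sub>j)\<close>, where the variables \<open>r\<^sub>i y\<^sub>j\<close> are ordered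
  lexicographically with \<open>j\<close> first. Truncating \<open>r\<close> to its first \<open>N\<close> terms turns this into the substitution
  \<open>x\<^sub>k \<mapsto> r\<^bsub>k mod N\<^esub> y\<^bsub>k div N\<^esub>\<close>, which is a ring homomorphism on all power series;
  on quasisymmetric functions its coefficients converge for \<open>N \<rightarrow> \<infinity>\<close>, so \<open>\<Phi>\<close> is multiplicative.
  Cutting \<open>\<alpha>\<close> into blocks according to \<open>j\<close> gives
  \<open>\<Phi> M\<^sub>\<alpha> = \<Sum> M\<^sub>\<beta>(r) M\<^sub>\<gamma>(r) \<dots> M\<^bsub>(|\<beta>|, |\<gamma>|, \<dots>)\<^esub>\<close>, summed over the factorisations
  \<open>\<alpha> = \<beta> \<cdot> \<gamma> \<cdot> \<dots>\<close>, from which compatibility with the coproduct is visible. The coefficient of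
  \<open>F\<^bsub>(n)\<^esub>\<close> in \<open>\<Phi> F\<^sub>\<alpha>\<close> is that of \<open>y\<^sub>0\<^sup>n\<close>, i.e. \<open>F\<^sub>\<alpha>(r)\<close>, and
  \<open>\<Sum>\<^sub>\<sigma> F\<^bsub>D(\<sigma>)\<^esub>(r) = (\<Sum>\<^sub>i r\<^sub>i)\<^sup>n = 1\<close> because stable sorting puts words in bijection with pairs
  of a permutation \<open>\<sigma>\<close> and a monomial of \<open>F\<^bsub>D(\<sigma>)\<^esub>\<close>.\<close>


section \<open>Coefficients of monomial quasisymmetric functions\<close>

text \<open>The type of a monomial: for positive parts, \<open>M_\<alpha>\<close> is the sum of the
  monomials \<open>m\<close> with \<open>exponents m = \<alpha>\<close>.\<close>

definition exponents :: "nat multiset \<Rightarrow> nat list" where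
  "exponents m = map (count m) (sorted_list_of_set (set_mset m))"

lemma exponents_empty [simp]: "exponents {#} = []"
  by (simp add: exponents_def)

lemma exponents_eq_Nil_iff [simp]: "exponents m = [] \<longleftrightarrow> m = {#}"
  by (simp add: exponents_def)

text \<open>Dividing out the full power of the least variable removes the first exponent; this
  recursion drives the inductions over \<open>exponents m\<close>.\<close>

lemma exponents_eq_Cons_iff:
  assumes "a > 0"
  shows "exponents m = a # \<alpha> \<longleftrightarrow> m \<noteq> {#} \<and> count m (Min (set_mset m)) = a \<and>
    exponents (m - replicate_mset a (Min (set_mset m))) = \<alpha>"
proof (cases "m = {#}")
  case False
  define x where "x = Min (set_mset m)"
  have "sorted_list_of_set (set_mset m) = x # sorted_list_of_set (set_mset m - {x})"
    unfolding x_def by (rule sorted_list_of_set_nonempty) (use False in auto)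
  then have *: "exponents m = count m x # map (count m) (sorted_list_of_set (set_mset m - {x}))"
    by (simp add: exponents_def)
  have "exponents (m - replicate_mset (count m x) x) =
      map (count m) (sorted_list_of_set (set_mset m - {x}))"
  proof -
    have "set_mset (m - replicate_mset (count m x) x) = set_mset m - {x}"
      by (auto simp: in_diff_count split: if_splits)
    then show ?thesis by (auto simp: exponents_def)
  qed
  then show ?thesis using False * by (auto simp: x_def)
qed (use assms in auto)

lemma exponents_nonzero: "0 \<notin> set (exponents m)"
  by (auto simp: exponents_def) (metis count_eq_zero_iff)

lemma sum_list_exponents [simp]: "sum_list (exponents m) = size m"
  by (simp add: exponents_def size_multiset_overloaded_eq sum_list_distinct_conv_sum_set)

text \<open>As all parts are positive, an index sequence producing \<open>m\<close> must list the
  support of \<open>m\<close> in increasing order. So there is at most one, and the cardinality in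
  \<open>qs_M\<close> is 0 or 1.\<close>

lemma mcoeff_qs_M:
  assumes "0 \<notin> set \<alpha>"
  shows "mcoeff (qs_M \<alpha>) m = of_bool (exponents m = \<alpha>)"
proof -
  let ?l = "sorted_list_of_set (set_mset m)"
  let ?S = "{i. length i = length \<alpha> \<and> sorted_wrt (<) i \<and>
     (\<Sum>j<length \<alpha>. replicate_mset (\<alpha> ! j) (i ! j)) = m}"
  have count: "count (\<Sum>j<length \<alpha>. replicate_mset (\<alpha> ! j) (i ! j)) x =
      (\<Sum>j<length \<alpha>. if i ! j = x then \<alpha> ! j else 0)" for i x
    by (auto simp: count_sum intro!: sum.cong)
  have "?S = (if exponents m = \<alpha> then {?l} else {})"
  proof -
    have 1: "i = ?l \<and> exponents m = \<alpha>" if "i \<in> ?S" for i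
    proof -
      have len: "length i = length \<alpha>" and srt: "sorted_wrt (<) i"
        and m: "(\<Sum>j<length \<alpha>. replicate_mset (\<alpha> ! j) (i ! j)) = m" using that by auto
      have "distinct i" using srt by (simp add: strict_sorted_iff)
      have cnt: "count m (i ! k) = \<alpha> ! k" if "k < length \<alpha>" for k
      proof -
        have "count m (i ! k) = (\<Sum>j<length \<alpha>. if j = k then \<alpha> ! j else 0)"
          unfolding m[symmetric] count
          by (rule sum.cong) (use \<open>distinct i\<close> that len in \<open>auto simp: nth_eq_iff_index_eq\<close>)
        then show ?thesis using that by simp
      qed
      have "set i = set_mset m"
      proof
        show "set i \<subseteq> set_mset m"
        proof
          fix x assume "x \<in> set i"
          then obtain k where k: "k < length \<alpha>" "x = i ! k" by (metis in_set_conv_nth len)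
          then have "count m x = \<alpha> ! k" "\<alpha> ! k \<noteq> 0" using cnt assms nth_mem by metis+
          then show "x \<in> set_mset m" by (metis count_eq_zero_iff)
        qed
        show "set_mset m \<subseteq> set i"
          unfolding m[symmetric] by (auto simp: len set_mset_sum split: if_splits)
      qed
      then have "i = ?l" using srt
        by (metis sorted_list_of_set.idem_if_sorted_distinct strict_sorted_iff)
      moreover have "map (count m) i = \<alpha>" by (rule nth_equalityI) (use len cnt in auto)
      ultimately show ?thesis by (simp add: exponents_def)
    qed
    have 2: "?l \<in> ?S" if "exponents m = \<alpha>"
    proof -
      have len: "length ?l = length \<alpha>" using that by (auto simp: exponents_def)
      have "(\<Sum>j<length \<alpha>. replicate_mset (\<alpha> ! j) (?l ! j)) =
        (\<Sum>j<length ?l. replicate_mset (count m (?l ! j)) (?l ! j))"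
        by (rule sum.cong) (use that in \<open>auto simp: exponents_def\<close>)
      also have "\<dots> = sum_list (map (\<lambda>x. replicate_mset (count m x) x) ?l)"
        by (simp add: sum_list_sum_nth atLeast0LessThan)
      also have "\<dots> = (\<Sum>x\<in>set_mset m. replicate_mset (count m x) x)"
        by (simp add: sum_list_distinct_conv_sum_set)
      also have "\<dots> = m"
        by (rule multiset_eqI) (auto simp: count_sum not_in_iff)
      finally show ?thesis using len by simp
    qed
    show ?thesis using 1 2 by auto
  qed
  then show ?thesis by (simp add: qs_M_def)
qed

section \<open>Single variables, and quasisymmetric polynomials in an interval of variables\<close>

definition var :: "'v \<Rightarrow> 'v mseries" where
  "var x = MSeries (\<lambda>m. of_bool (m = {#x#}))"

lemma mcoeff_one: "mcoeff 1 m = of_bool (m = {#})"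
  by transfer simp

lemma mcoeff_times: "mcoeff (f * g) m = (\<Sum>a | a \<subseteq># m. mcoeff f a * mcoeff g (m - a))"
  by transfer simp

lemma mcoeff_monomial_times:
  assumes "\<And>m. mcoeff p m = of_bool (m = a)"
  shows "mcoeff (p * f) m = (if a \<subseteq># m then mcoeff f (m - a) else 0)"
proof -
  have "mcoeff (p * f) m = (\<Sum>b\<in>{b. b \<subseteq># m}. if b = a then mcoeff f (m - b) else 0)"
    by (auto simp: mcoeff_times assms intro!: sum.cong)
  then show ?thesis by (simp add: finite_submultisets)
qed

lemma mcoeff_var_power: "mcoeff (var x ^ k) m = of_bool (m = replicate_mset k x)"
proof (induction k arbitrary: m)
  case (Suc k)
  have "mcoeff (var x ^ Suc k) m = (if {#x#} \<subseteq># m then mcoeff (var x ^ k) (m - {#x#}) else 0)"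
    unfolding power_Suc by (rule mcoeff_monomial_times) (simp add: var_def)
  also have "\<dots> = of_bool (m = replicate_mset (Suc k) x)"
    by (auto simp: Suc.IH dest: insert_DiffM)
  finally show ?case .
qed (simp add: mcoeff_one)

text \<open>The polynomial \<open>M_\<alpha>\<close> in the finitely many variables
  \<open>x i\<close> with \<open>s \<le> i < t\<close>, by recursion on the least index used. The
  ring is arbitrary, so that one definition covers truncated series (\<open>x = var\<close>) and
  real values (\<open>x = r\<close>).\<close>

fun qs_poly :: "(nat \<Rightarrow> 'a::comm_ring_1) \<Rightarrow> nat list \<Rightarrow> nat \<Rightarrow> nat \<Rightarrow> 'a" where
  "qs_poly x [] s t = 1"
| "qs_poly x (a # \<alpha>) s t = (\<Sum>i\<in>{s..<t}. x i ^ a * qs_poly x \<alpha> (Suc i) t)"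

lemma qs_poly_refl: "qs_poly x \<alpha> s s = of_bool (\<alpha> = [])"
  by (cases \<alpha>) auto

text \<open>The indices increase, so the parts with index below \<open>t\<close> form a prefix of
  \<open>\<alpha>\<close>: evaluating on a concatenated alphabet deconcatenates
  \<open>\<alpha>\<close>.\<close>

lemma qs_poly_split:
  assumes "s \<le> t" "t \<le> u"
  shows "qs_poly x \<alpha> s u = (\<Sum>j\<le>length \<alpha>. qs_poly x (take j \<alpha>) s t * qs_poly x (drop j \<alpha>) t u)"
  using assms(1)
proof (induction \<alpha> arbitrary: s)
  case (Cons a \<alpha>)
  have "qs_poly x (a # \<alpha>) s u = (\<Sum>i\<in>{s..<t}. x i ^ a * qs_poly x \<alpha> (Suc i) u)
      + qs_poly x (a # \<alpha>) t u"
    by (simp add: sum.atLeastLessThan_concat[OF Cons.prems assms(2)])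
  also have "(\<Sum>i\<in>{s..<t}. x i ^ a * qs_poly x \<alpha> (Suc i) u) =
      (\<Sum>i\<in>{s..<t}. \<Sum>j\<le>length \<alpha>. x i ^ a * qs_poly x (take j \<alpha>) (Suc i) t * qs_poly x (drop j \<alpha>) t u)"
    by (rule sum.cong) (simp_all add: Cons.IH sum_distrib_left mult.assoc)
  also have "\<dots> = (\<Sum>j\<le>length \<alpha>. qs_poly x (a # take j \<alpha>) s t * qs_poly x (drop j \<alpha>) t u)"
    by (subst sum.swap) (simp add: sum_distrib_right)
  finally show ?case
    by (simp del: qs_poly.simps(2) sum.atMost_Suc add: sum.atMost_Suc_shift add.commute)
qed simp

lemma qs_poly_shift: "qs_poly x \<alpha> (s + c) (t + c) = qs_poly (\<lambda>i. x (i + c)) \<alpha> s t"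
proof (induction \<alpha> arbitrary: s)
  case (Cons a \<alpha>)
  then show ?case using Cons[of "Suc _"]
    by (simp add: sum.shift_bounds_nat_ivl)
qed simp

lemma qs_poly_cong:
  "(\<And>i. s \<le> i \<Longrightarrow> i < t \<Longrightarrow> x i = y i) \<Longrightarrow> qs_poly x \<alpha> s t = qs_poly y \<alpha> s t"
  by (induction \<alpha> arbitrary: s) (auto intro!: sum.cong)

text \<open>Homogeneity of degree \<open>sum_list \<alpha>\<close>; this treats one block of the
  alphabet, in which all variables share the factor \<open>y\<close>.\<close>

lemma qs_poly_scaleR:
  fixes y :: "'a::{comm_ring_1, real_algebra_1}"
  shows "qs_poly (\<lambda>i. c i *\<^sub>R y) \<alpha> s t = qs_poly c \<alpha> s t *\<^sub>R y ^ sum_list \<alpha>"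
proof -
  have pow: "(d *\<^sub>R y) ^ k = d ^ k *\<^sub>R y ^ k" for d k
    by (induction k) simp_all
  show ?thesis
    by (induction \<alpha> arbitrary: s) (simp_all add: pow scaleR_sum_left power_add mult.commute)
qed

lemma qs_poly_hom:
  assumes "\<phi> 1 = 1" "\<phi> 0 = 0" "\<And>f g. \<phi> (f + g) = \<phi> f + \<phi> g" "\<And>f g. \<phi> (f * g) = \<phi> f * \<phi> g"
  shows "\<phi> (qs_poly x \<alpha> s t) = qs_poly (\<lambda>i. \<phi> (x i)) \<alpha> s t"
proof -
  have pow: "\<phi> (f ^ k) = \<phi> f ^ k" for f k by (induction k) (simp_all add: assms)
  have sum: "\<phi> (sum f A) = (\<Sum>a\<in>A. \<phi> (f a))" for f :: "nat \<Rightarrow> _" and A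
    by (induction A rule: infinite_finite_induct) (simp_all add: assms)
  show ?thesis
    by (induction \<alpha> arbitrary: s) (simp_all add: pow sum assms)
qed

text \<open>On monomials supported in \<open>{s..<t}\<close> the coefficients agree with those of
  \<open>qs_M \<alpha>\<close>, so the polynomial may replace the series there. In the induction
  only the summand at the least variable of \<open>m\<close> contributes.\<close>

lemma mcoeff_qs_poly_var:
  assumes "0 \<notin> set \<alpha>"
  shows "mcoeff (qs_poly var \<alpha> s t) m = of_bool (set_mset m \<subseteq> {s..<t} \<and> exponents m = \<alpha>)"
  using assms
proof (induction \<alpha> arbitrary: s m)
  case Nil
  then show ?case by (auto simp: mcoeff_one)
next
  case (Cons a \<alpha>)
  have a: "a > 0" using Cons.prems by auto
  define x where "x = Min (set_mset m)"
  have summand: "mcoeff (var i ^ a * qs_poly var \<alpha> (Suc i) t) m =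
      of_bool (set_mset m \<subseteq> {s..<t} \<and> exponents m = a # \<alpha> \<and> i = x)"
    if i: "i \<in> {s..<t}" for i
  proof -
    let ?m = "m - replicate_mset a i"
    have "mcoeff (var i ^ a * qs_poly var \<alpha> (Suc i) t) m =
        of_bool (replicate_mset a i \<subseteq># m \<and> set_mset ?m \<subseteq> {Suc i..<t} \<and> exponents ?m = \<alpha>)"
      using Cons by (simp add: mcoeff_monomial_times[OF mcoeff_var_power])
    also have "(replicate_mset a i \<subseteq># m \<and> set_mset ?m \<subseteq> {Suc i..<t} \<and> exponents ?m = \<alpha>) \<longleftrightarrow>
      (set_mset m \<subseteq> {s..<t} \<and> exponents m = a # \<alpha> \<and> i = x)"
    proof
      assume *: "replicate_mset a i \<subseteq># m \<and> set_mset ?m \<subseteq> {Suc i..<t} \<and> exponents ?m = \<alpha>"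
      then have m: "m = ?m + replicate_mset a i" by simp
      have set_m: "set_mset m = insert i (set_mset ?m)"
        using a by (subst m) auto
      have "x = i" unfolding x_def by (rule Min_eqI) (use * in \<open>auto simp: set_m\<close>)
      moreover have "i \<notin># ?m" using * by auto
      then have "count m i = a" using m by (metis count_replicate_mset count_union add_0 count_eq_zero_iff)
      ultimately have "exponents m = a # \<alpha>"
        using a * set_m by (auto simp: exponents_eq_Cons_iff x_def)
      then show "set_mset m \<subseteq> {s..<t} \<and> exponents m = a # \<alpha> \<and> i = x"
        using * i \<open>x = i\<close> by (auto simp: set_m)
    next
      assume *: "set_mset m \<subseteq> {s..<t} \<and> exponents m = a # \<alpha> \<and> i = x"
      then have c: "count m i = a" "exponents ?m = \<alpha>" "m \<noteq> {#}"
        using a by (auto simp: exponents_eq_Cons_iff x_def)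
      have "set_mset ?m = set_mset m - {i}"
        using c by (auto simp: in_diff_count split: if_splits)
      moreover have "\<And>y. y \<in># m \<Longrightarrow> i \<le> y" using * by (simp add: x_def)
      ultimately have "set_mset ?m \<subseteq> {Suc i..<t}"
        using * by (auto simp: Suc_le_eq order.not_eq_order_implies_strict subset_iff)
      then show "replicate_mset a i \<subseteq># m \<and> set_mset ?m \<subseteq> {Suc i..<t} \<and> exponents ?m = \<alpha>"
        using c by (simp add: count_le_replicate_mset_subset_eq[symmetric])
    qed
    finally show ?thesis .
  qed
  have "mcoeff (qs_poly var (a # \<alpha>) s t) m = (\<Sum>i\<in>{s..<t}. if i = x then
      of_bool (set_mset m \<subseteq> {s..<t} \<and> exponents m = a # \<alpha>) else 0)"
    unfolding qs_poly.simps mcoeff_sum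
    by (rule sum.cong[OF refl], subst summand) (auto simp del: atLeastLessThan_iff)
  also have "\<dots> = of_bool (set_mset m \<subseteq> {s..<t} \<and> exponents m = a # \<alpha> \<and> x \<in> {s..<t})"
    by (simp add: sum.delta of_bool_def del: atLeastLessThan_iff)
  also have "\<dots> = of_bool (set_mset m \<subseteq> {s..<t} \<and> exponents m = a # \<alpha>)"
  proof -
    have "x \<in> {s..<t}" if "set_mset m \<subseteq> {s..<t}" "exponents m = a # \<alpha>"
    proof -
      have "m \<noteq> {#}" using that by auto
      then have "x \<in> set_mset m" unfolding x_def by (intro Min_in) auto
      then show ?thesis using that by blast
    qed
    then show ?thesis by (auto simp del: atLeastLessThan_iff)
  qed
  finally show ?case .
qed


section \<open>Substitution of monomials\<close>

text \<open>A monomial over \<open>m\<close> has degree \<open>size m\<close> and its variables lie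
  over the finite support of \<open>m\<close>. This makes the sum in \<open>msubst\<close>
  finite.\<close>

lemma finite_vimage_image_mset:
  assumes "\<And>y. finite (h -` {y})"
  shows "finite {M. image_mset h M = m}"
proof (rule finite_subset)
  let ?X = "h -` set_mset m"
  have "?X = (\<Union>y\<in>set_mset m. h -` {y})" by auto
  then have "finite ?X" using assms by simp
  then show "finite (mset ` {xs. set xs \<subseteq> ?X \<and> length xs = size m})"
    by (intro finite_imageI finite_lists_length_eq)
  show "{M. image_mset h M = m} \<subseteq> mset ` {xs. set xs \<subseteq> ?X \<and> length xs = size m}"
  proof
    fix M assume "M \<in> {M. image_mset h M = m}"
    moreover obtain xs where "M = mset xs" by (metis ex_mset)
    ultimately show "M \<in> mset ` {xs. set xs \<subseteq> ?X \<and> length xs = size m}" by auto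
  qed
qed

text \<open>The substitution of \<open>c i * y_(h i)\<close> for the variable \<open>x_i\<close>. It
  is meant for \<open>h\<close> with finite fibres, since a sum over an infinite set defaults to
  0.\<close>

definition msubst :: "('v \<Rightarrow> 'w) \<Rightarrow> ('v \<Rightarrow> real) \<Rightarrow> 'v mseries \<Rightarrow> 'w mseries" where
  "msubst h c f = MSeries (\<lambda>m. \<Sum>M | image_mset h M = m. mcoeff f M * (\<Prod>i\<in>#M. c i))"

lemma mcoeff_msubst:
  "mcoeff (msubst h c f) m = (\<Sum>M | image_mset h M = m. mcoeff f M * (\<Prod>i\<in>#M. c i))"
  by (simp add: msubst_def)

lemma msubst_add: "msubst h c (f + g) = msubst h c f + msubst h c g"
  by (rule mseries_eqI) (simp add: mcoeff_msubst algebra_simps sum.distrib)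

lemma msubst_scaleR: "msubst h c (a *\<^sub>R f) = a *\<^sub>R msubst h c f"
  by (rule mseries_eqI) (simp add: mcoeff_msubst sum_distrib_left mult.assoc)

lemma msubst_zero [simp]: "msubst h c 0 = 0"
  by (rule mseries_eqI) (simp add: mcoeff_msubst)

lemma mcoeff_msubst_empty: "mcoeff (msubst h c f) {#} = mcoeff f {#}"
  by (simp add: mcoeff_msubst)

lemma msubst_one [simp]:
  assumes "\<And>y. finite (h -` {y})"
  shows "msubst h c 1 = 1"
proof (rule mseries_eqI)
  fix m
  have "mcoeff (msubst h c 1) m = (\<Sum>M\<in>{M. image_mset h M = m}. if M = {#} then 1 else 0)"
    unfolding mcoeff_msubst by (rule sum.cong) (auto simp: mcoeff_one)
  also have "\<dots> = of_bool (m = {#})"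
    by (auto simp: finite_vimage_image_mset[OF assms])
  finally show "mcoeff (msubst h c 1) m = mcoeff 1 m" by (simp add: mcoeff_one)
qed

lemma msubst_var:
  assumes "\<And>y. finite (h -` {y})"
  shows "msubst h c (var x) = c x *\<^sub>R var (h x)"
proof (rule mseries_eqI)
  fix m
  have "mcoeff (msubst h c (var x)) m =
      (\<Sum>M\<in>{M. image_mset h M = m}. if M = {#x#} then c x else 0)"
    unfolding mcoeff_msubst by (rule sum.cong) (auto simp: var_def)
  also have "\<dots> = c x * of_bool (m = {#h x#})"
    by (auto simp: finite_vimage_image_mset[OF assms])
  finally show "mcoeff (msubst h c (var x)) m = mcoeff (c x *\<^sub>R var (h x)) m"
    by (simp add: var_def)
qed

text \<open>A monomial \<open>M\<close> over \<open>m\<close> with a divisor \<open>A\<close>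
  amounts to a divisor \<open>a\<close> of \<open>m\<close>, a monomial \<open>A\<close> over
  \<open>a\<close> and a monomial \<open>B = M - A\<close> over \<open>m - a\<close>; the factor
  from \<open>c\<close> is multiplicative.\<close>

lemma msubst_mult:
  assumes fin: "\<And>y. finite (h -` {y})"
  shows "msubst h c (f * g) = msubst h c f * msubst h c g"
proof (rule mseries_eqI)
  fix m
  define \<phi> where "\<phi> f M = mcoeff f M * (\<Prod>i\<in>#M. c i)" for f M
  let ?P = "\<lambda>m. {M. image_mset h M = m}"
  have fin: "finite (?P m)" for m by (rule finite_vimage_image_mset[OF fin])
  have "mcoeff (msubst h c (f * g)) m = (\<Sum>M\<in>?P m. \<Sum>A | A \<subseteq># M. \<phi> f A * \<phi> g (M - A))"
    unfolding mcoeff_msubst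
  proof (rule sum.cong[OF refl])
    fix M
    have "\<phi> f A * \<phi> g (M - A) = mcoeff f A * mcoeff g (M - A) * (\<Prod>i\<in>#M. c i)" if "A \<subseteq># M" for A
    proof -
      have "(\<Prod>i\<in>#M. c i) = (\<Prod>i\<in>#A. c i) * (\<Prod>i\<in>#M - A. c i)"
        using that by (metis image_mset_union prod_mset_Un subset_mset.add_diff_inverse)
      then show ?thesis by (simp add: \<phi>_def)
    qed
    then show "mcoeff (f * g) M * (\<Prod>i\<in>#M. c i) = (\<Sum>A | A \<subseteq># M. \<phi> f A * \<phi> g (M - A))"
      by (simp add: mcoeff_times sum_distrib_right)
  qed
  also have "\<dots> = (\<Sum>(M, A)\<in>(SIGMA M:?P m. {A. A \<subseteq># M}). \<phi> f A * \<phi> g (M - A))"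
    by (rule sum.Sigma) (use fin finite_submultisets in auto)
  also have "\<dots> = (\<Sum>(a, A, B)\<in>(SIGMA a:{a. a \<subseteq># m}. ?P a \<times> ?P (m - a)). \<phi> f A * \<phi> g B)"
    by (rule sum.reindex_bij_witness[of _ "\<lambda>(a, A, B). (A + B, A)"
          "\<lambda>(M, A). (image_mset h A, A, M - A)"])
      (auto simp: image_mset_Diff image_mset_subseteq_mono)
  also have "\<dots> = (\<Sum>a | a \<subseteq># m. \<Sum>(A, B)\<in>?P a \<times> ?P (m - a). \<phi> f A * \<phi> g B)"
    by (rule sum.Sigma[symmetric]) (use fin finite_submultisets in auto)
  also have "\<dots> = mcoeff (msubst h c f * msubst h c g) m"
    by (simp add: mcoeff_times mcoeff_msubst sum_product sum.cartesian_product \<phi>_def)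
  finally show "mcoeff (msubst h c (f * g)) m = mcoeff (msubst h c f * msubst h c g) m" .
qed

section \<open>Cutting a composition into consecutive blocks\<close>

definition factorizations :: "nat list \<Rightarrow> nat list list set" where
  "factorizations \<alpha> = {xss. concat xss = \<alpha> \<and> [] \<notin> set xss}"

lemma factorizations_Nil [simp]: "factorizations [] = {[]}"
  by (auto simp: factorizations_def) (metis last_in_set)

lemma factorizations_rec:
  assumes "\<alpha> \<noteq> []"
  shows "factorizations \<alpha> = (\<Union>j\<in>{1..length \<alpha>}. (#) (take j \<alpha>) ` factorizations (drop j \<alpha>))"
proof (intro equalityI subsetI)
  fix xss assume *: "xss \<in> factorizations \<alpha>"
  then obtain xs yss where xss: "xss = xs # yss"
    using assms by (cases xss) (auto simp: factorizations_def)
  have "xs = take (length xs) \<alpha>" "yss \<in> factorizations (drop (length xs) \<alpha>)"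
    "length xs \<in> {1..length \<alpha>}"
    using * by (auto simp: xss factorizations_def Suc_le_eq)
  then show "xss \<in> (\<Union>j\<in>{1..length \<alpha>}. (#) (take j \<alpha>) ` factorizations (drop j \<alpha>))"
    unfolding xss by blast
qed (use assms in \<open>auto simp: factorizations_def\<close>)

text \<open>Every factor uses up at least one part; admitting empty factors would make the set
  infinite.\<close>

lemma finite_factorizations: "finite (factorizations \<alpha>)"
proof (induction \<alpha> rule: length_induct)
  case (1 \<alpha>)
  then show ?case
    by (cases "\<alpha> = []") (auto simp: factorizations_rec)
qed

lemma sum_factorizations:
  assumes "\<alpha> \<noteq> []"
  shows "(\<Sum>xss\<in>factorizations \<alpha>. g xss) =
    (\<Sum>j\<in>{1..length \<alpha>}. \<Sum>yss\<in>factorizations (drop j \<alpha>). g (take j \<alpha> # yss))"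
proof -
  have "take i \<alpha> \<noteq> take j \<alpha>" if "i \<le> length \<alpha>" "j \<le> length \<alpha>" "i \<noteq> j" for i j
    using that by (metis length_take min.absorb2)
  then show ?thesis
    unfolding factorizations_rec[OF assms]
    by (subst sum.UNION_disjoint) (auto simp: finite_factorizations sum.reindex)
qed

lemma qs_poly_step:
  assumes "s < t"
  shows "qs_poly x \<alpha> s t = qs_poly x \<alpha> (Suc s) t +
    (case \<alpha> of [] \<Rightarrow> 0 | a # \<beta> \<Rightarrow> x s ^ a * qs_poly x \<beta> (Suc s) t)"
  using assms by (cases \<alpha>) (simp_all add: sum.atLeast_Suc_lessThan add.commute)

text \<open>\<open>qs_poly x \<alpha>\<close> on the alphabet \<open>r i y j\<close>, ordered lexicographically with \<open>j\<close> first: the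
  factors of \<open>\<alpha>\<close> are the parts that fall into the same block \<open>j\<close>.\<close>

lemma qs_poly_blocks:
  fixes y :: "nat \<Rightarrow> 'a::{comm_ring_1, real_algebra_1}"
  assumes "s \<le> J" "N > 0"
  shows "qs_poly (\<lambda>k. r (k mod N) *\<^sub>R y (k div N)) \<alpha> (s * N) (J * N) =
    (\<Sum>xss\<in>factorizations \<alpha>. (\<Prod>xs\<leftarrow>xss. qs_poly r xs 0 N) *\<^sub>R
       qs_poly y (map sum_list xss) s J)"
  using assms(1)
proof (induction s arbitrary: \<alpha> rule: inc_induct)
  case base
  show ?case
  proof (cases "\<alpha> = []")
    case False
    then have "xss \<noteq> []" if "xss \<in> factorizations \<alpha>" for xss
      using that by (auto simp: factorizations_def)
    then show ?thesis using False by (auto simp: qs_poly_refl intro!: sum.neutral)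
  qed (simp add: qs_poly_refl)
next
  case (step s)
  let ?X = "\<lambda>k. r (k mod N) *\<^sub>R y (k div N)"
  let ?z = "\<lambda>xs. qs_poly r xs 0 N"
  let ?w = "\<lambda>xss. \<Prod>xs\<leftarrow>xss. ?z xs"
  \<comment> \<open>Inside block \<open>s\<close> the quotient \<open>k div N\<close> is constantly
    \<open>s\<close>, while \<open>k mod N\<close> runs through the first \<open>N\<close> indices
    of \<open>r\<close>.\<close>
  have block: "qs_poly ?X \<beta> (s * N) (Suc s * N) = ?z \<beta> *\<^sub>R y s ^ sum_list \<beta>" for \<beta>
  proof -
    have "qs_poly ?X \<beta> (0 + s * N) (N + s * N) = qs_poly (\<lambda>k. r k *\<^sub>R y s) \<beta> 0 N"
      unfolding qs_poly_shift by (rule qs_poly_cong) (use assms in simp)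
    then show ?thesis by (simp add: qs_poly_scaleR)
  qed
  have "qs_poly ?X \<alpha> (s * N) (J * N) = (\<Sum>j\<le>length \<alpha>.
      (?z (take j \<alpha>) *\<^sub>R y s ^ sum_list (take j \<alpha>)) * qs_poly ?X (drop j \<alpha>) (Suc s * N) (J * N))"
    using step.hyps unfolding block[symmetric]
    by (intro qs_poly_split mult_le_mono1) auto
  also have "\<dots> = (\<Sum>j\<le>length \<alpha>. \<Sum>yss\<in>factorizations (drop j \<alpha>). ?w (take j \<alpha> # yss) *\<^sub>R
      (y s ^ sum_list (take j \<alpha>) * qs_poly y (map sum_list yss) (Suc s) J))"
    by (simp only: step.IH sum_distrib_left) (simp add: mult.commute)
  \<comment> \<open>The term \<open>j = 0\<close>, where no part falls into block \<open>s\<close>,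
    is separated; for \<open>j \<ge> 1\<close> the prefix \<open>take j \<alpha>\<close> becomes the
    first factor. By \<open>qs_poly_step\<close> the two sums recombine to the value on the
    variables from \<open>s\<close> on.\<close>
  also have "\<dots> = (\<Sum>yss\<in>factorizations \<alpha>. ?w yss *\<^sub>R qs_poly y (map sum_list yss) (Suc s) J) +
     (\<Sum>j\<in>{1..length \<alpha>}. \<Sum>yss\<in>factorizations (drop j \<alpha>). ?w (take j \<alpha> # yss) *\<^sub>R
      (y s ^ sum_list (take j \<alpha>) * qs_poly y (map sum_list yss) (Suc s) J))"
    by (simp add: atMost_atLeast0 sum.atLeast_Suc_atMost)
  also have "(\<Sum>j\<in>{1..length \<alpha>}. \<Sum>yss\<in>factorizations (drop j \<alpha>). ?w (take j \<alpha> # yss) *\<^sub>R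
      (y s ^ sum_list (take j \<alpha>) * qs_poly y (map sum_list yss) (Suc s) J)) =
    (\<Sum>xss\<in>factorizations \<alpha>. ?w xss *\<^sub>R (case xss of [] \<Rightarrow> 0 | xs # yss \<Rightarrow>
       y s ^ sum_list xs * qs_poly y (map sum_list yss) (Suc s) J))"
    by (cases "\<alpha> = []") (simp_all add: sum_factorizations)
  also have "(\<Sum>yss\<in>factorizations \<alpha>. ?w yss *\<^sub>R qs_poly y (map sum_list yss) (Suc s) J) + \<dots> =
    (\<Sum>xss\<in>factorizations \<alpha>. ?w xss *\<^sub>R qs_poly y (map sum_list xss) s J)"
    unfolding sum.distrib[symmetric] scaleR_add_right[symmetric]
    by (intro sum.cong refl arg_cong2[where f = scaleR])
      (use step.hyps in \<open>simp add: qs_poly_step split: list.split\<close>)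
  finally show ?case .
qed


section \<open>Linear independence and the coproduct\<close>

lemma linear_mcoeff: "linear (\<lambda>f. mcoeff f m)"
  by (rule linearI) auto

lemma all_compositions_eq: "all_compositions = {\<alpha>. 0 \<notin> set \<alpha>}"
  by (auto simp: all_compositions_def compositions_def)

lemma ex_exponents_eq:
  assumes "0 \<notin> set \<alpha>"
  shows "\<exists>m. exponents m = \<alpha>"
proof -
  \<comment> \<open>The lower bound \<open>s\<close> on the support leaves room for a smaller
    variable in the induction step.\<close>
  have "\<exists>m. exponents m = \<alpha> \<and> set_mset m \<subseteq> {s..}" for s
    using assms
  proof (induction \<alpha> arbitrary: s)
    case (Cons a \<alpha>)
    then obtain m where m: "exponents m = \<alpha>" "set_mset m \<subseteq> {Suc s..}" by force
    let ?m = "replicate_mset a s + m"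
    have a: "a > 0" using Cons.prems by auto
    have "Min (set_mset ?m) = s" by (rule Min_eqI) (use m a in \<open>auto dest: subsetD\<close>)
    moreover have "s \<notin># m" using m by auto
    ultimately have "exponents ?m = a # \<alpha>"
      using a m by (auto simp: exponents_eq_Cons_iff not_in_iff)
    moreover have "set_mset ?m \<subseteq> {s..}" using m by (auto dest: subsetD split: if_splits)
    ultimately show ?case by blast
  qed (auto intro!: exI[of _ "{#}"])
  then show ?thesis by blast
qed

text \<open>In a vanishing combination, take an index \<open>i\<close> of least rank among those
  with nonzero coefficient: \<open>e i\<close> then annihilates every other term. A constant rank is
  the case of a dual family; the \<open>qs_F\<close> need a proper rank.\<close>

lemma triangular_family_independent:
  fixes b :: "'i \<Rightarrow> 'a::real_vector" and e :: "'i \<Rightarrow> 'a \<Rightarrow> real" and rank :: "'i \<Rightarrow> nat"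
  assumes lin: "\<And>i. i \<in> I \<Longrightarrow> linear (e i)"
    and diag: "\<And>i. i \<in> I \<Longrightarrow> e i (b i) \<noteq> 0"
    and tri: "\<And>i j. i \<in> I \<Longrightarrow> j \<in> I \<Longrightarrow> e i (b j) \<noteq> 0 \<Longrightarrow> j = i \<or> rank j < rank i"
  shows "inj_on b I" "independent (b ` I)"
proof -
  show inj: "inj_on b I"
  proof (rule inj_onI, rule ccontr)
    fix i j assume "i \<in> I" "j \<in> I" "b i = b j" "i \<noteq> j"
    then show False using diag[of i] diag[of j] tri[of i j] tri[of j i] by auto
  qed
  show "independent (b ` I)"
  proof
    assume "dependent (b ` I)"
    then obtain t u v where t: "finite t" "t \<subseteq> b ` I" "(\<Sum>v\<in>t. u v *\<^sub>R v) = 0" "v \<in> t" "u v \<noteq> 0"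
      unfolding dependent_explicit by blast
    define S where "S = {i \<in> I. b i \<in> t \<and> u (b i) \<noteq> 0}"
    have "finite S" unfolding S_def
      by (rule finite_subset[OF _ finite_vimage_IntI[OF t(1) inj]]) auto
    moreover have "S \<noteq> {}" using t unfolding S_def by auto
    ultimately obtain i where i: "i \<in> S" "\<And>j. j \<in> S \<Longrightarrow> rank i \<le> rank j"
      using ex_min_if_finite[of "rank ` S"] by (auto simp: not_less)
    then have iI: "i \<in> I" "b i \<in> t" "u (b i) \<noteq> 0" by (auto simp: S_def)
    interpret linear "e i" by (rule lin[OF iI(1)])
    have "0 = e i (\<Sum>v\<in>t. u v *\<^sub>R v)" using t by (simp add: zero)
    also have "\<dots> = (\<Sum>v\<in>t. u v * e i v)" by (simp add: sum scale)
    also have "\<dots> = (\<Sum>v\<in>t. if v = b i then u v * e i v else 0)"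
    proof (rule sum.cong[OF refl])
      fix v assume "v \<in> t"
      then obtain j where j: "v = b j" "j \<in> I" using t by auto
      have "j = i" if "u v * e i v \<noteq> 0"
        using tri[OF iI(1) j(2)] i(2)[of j] that j \<open>v \<in> t\<close> by (force simp: S_def)
      then show "u v * e i v = (if v = b i then u v * e i v else 0)" using j by auto
    qed
    also have "\<dots> = u (b i) * e i (b i)" using t iI by simp
    finally show False using diag iI by simp
  qed
qed

lemma qs_M_inj: "inj_on qs_M all_compositions"
  and qs_M_independent: "independent (qs_M ` all_compositions)"
proof -
  \<comment> \<open>Reading off the coefficient at one chosen monomial of type
    \<open>\<alpha>\<close> gives functionals dual to the \<open>qs_M\<close>.\<close>
  define e where "e = (\<lambda>\<alpha> f. mcoeff f (SOME m. exponents m = \<alpha>))"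
  have e: "e \<alpha> (qs_M \<beta>) = of_bool (\<alpha> = \<beta>)" if "\<alpha> \<in> all_compositions" "\<beta> \<in> all_compositions" for \<alpha> \<beta>
    using someI_ex[OF ex_exponents_eq, of \<alpha>] that
    by (auto simp: e_def mcoeff_qs_M all_compositions_eq)
  have "linear (e \<alpha>)" for \<alpha> by (simp add: e_def linear_mcoeff)
  note * = triangular_family_independent[of all_compositions e qs_M "\<lambda>_. 0", OF this]
  show "inj_on qs_M all_compositions" "independent (qs_M ` all_compositions)"
    by (rule *; use e in \<open>auto simp: of_bool_def split: if_splits\<close>)+
qed

section \<open>Tensor products and the coproduct on the monomial basis\<close>

lemma mcoeff_tensor:
  "mcoeff (tensor f g) (image_mset Inl m + image_mset Inr m') = mcoeff f m * mcoeff g m'"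
  by (simp add: tensor_def filter_mset_image_mset multiset.map_comp comp_def)

lemma bilinear_tensor: "bilinear tensor"
  unfolding bilinear_def
  by (auto intro!: linearI mseries_eqI simp: tensor_def algebra_simps)

definition tensor_M :: "nat list \<times> nat list \<Rightarrow> (nat + nat) mseries" where
  "tensor_M = (\<lambda>(\<beta>, \<gamma>). tensor (qs_M \<beta>) (qs_M \<gamma>))"

lemma tensor_M_inj: "inj_on tensor_M (all_compositions \<times> all_compositions)"
  and tensor_M_independent: "independent (tensor_M ` (all_compositions \<times> all_compositions))"
proof -
  define s where "s = (\<lambda>\<alpha>. SOME m. exponents m = \<alpha>)"
  define e where "e = (\<lambda>(\<alpha>, \<alpha>') f. mcoeff f (image_mset Inl (s \<alpha>) + image_mset Inr (s \<alpha>')))"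
  have s: "exponents (s \<alpha>) = \<alpha>" if "\<alpha> \<in> all_compositions" for \<alpha>
    using someI_ex[OF ex_exponents_eq, of \<alpha>] that by (auto simp: s_def all_compositions_eq)
  have e: "e p (tensor_M q) = of_bool (p = q)"
    if "p \<in> all_compositions \<times> all_compositions" "q \<in> all_compositions \<times> all_compositions" for p q
    using that s by (auto simp: e_def tensor_M_def mcoeff_tensor mcoeff_qs_M all_compositions_eq)
  have "linear (e p)" for p by (auto simp: e_def linear_mcoeff split: prod.split)
  note * = triangular_family_independent[of "all_compositions \<times> all_compositions" e tensor_M "\<lambda>_. 0", OF this]
  show "inj_on tensor_M (all_compositions \<times> all_compositions)"
    "independent (tensor_M ` (all_compositions \<times> all_compositions))"
    by (rule *; use e in \<open>auto simp: of_bool_def split: if_splits\<close>)+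
qed

lemma QSym_eq: "QSym = span (qs_M ` all_compositions)"
proof -
  have "QSym \<subseteq> span (qs_M ` all_compositions)" unfolding QSym_def QSym_deg_def
    by (intro span_minimal UN_least span_mono) (auto simp: all_compositions_def)
  moreover have "qs_M ` all_compositions \<subseteq> (\<Union>n. QSym_deg n)"
    unfolding QSym_deg_def all_compositions_def by (auto intro!: span_base)
  then have "span (qs_M ` all_compositions) \<subseteq> QSym" unfolding QSym_def by (rule span_mono)
  ultimately show ?thesis by blast
qed

lemma qs_M_in_QSym: "\<alpha> \<in> all_compositions \<Longrightarrow> qs_M \<alpha> \<in> QSym"
  by (auto simp: QSym_eq intro: span_base)

lemma subspace_QSym: "subspace QSym"
  by (simp add: QSym_eq)

lemma qs_M_Nil: "qs_M [] = 1"
  by (rule mseries_eqI) (simp add: mcoeff_qs_M mcoeff_one)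

lemma one_in_QSym: "1 \<in> QSym"
  using qs_M_in_QSym[of "[]"] by (simp add: qs_M_Nil all_compositions_eq)

lemma linear_coproduct: "linear coproduct"
  unfolding coproduct_def by (rule linear_construct[OF qs_M_independent])

lemma coproduct_qs_M:
  assumes "\<alpha> \<in> all_compositions"
  shows "coproduct (qs_M \<alpha>) = (\<Sum>(\<beta>, \<gamma>) | \<beta> @ \<gamma> = \<alpha>. tensor (qs_M \<beta>) (qs_M \<gamma>))"
  unfolding coproduct_def using assms
  by (subst construct_basis[OF qs_M_independent]) (auto simp: the_inv_into_f_f[OF qs_M_inj])

lemma finite_splits: "finite {(xs, ys). xs @ ys = zs}"
proof (rule finite_subset)
  show "{(xs, ys). xs @ ys = zs} \<subseteq> (\<lambda>j. (take j zs, drop j zs)) ` {..length zs}"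
  proof clarify
    fix xs ys assume "zs = xs @ ys"
    then show "(xs, ys) \<in> (\<lambda>j. (take j (xs @ ys), drop j (xs @ ys))) ` {..length (xs @ ys)}"
      by (intro image_eqI[of _ _ "length xs"]) auto
  qed
qed simp

text \<open>The block length is \<open>Suc N\<close> to keep it positive: with length 0,
  \<open>k div 0 = 0\<close> would give an infinite fibre.\<close>

definition block_subst :: "(nat \<Rightarrow> real) \<Rightarrow> nat \<Rightarrow> nat mseries \<Rightarrow> nat mseries" where
  "block_subst r N = msubst (\<lambda>k. k div Suc N) (\<lambda>k. r (k mod Suc N))"

lemma finite_vimage_div_Suc: "finite ((\<lambda>k. k div Suc N) -` {y})"
proof (rule finite_subset)
  show "(\<lambda>k. k div Suc N) -` {y} \<subseteq> {..<Suc y * Suc N}"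
    by (auto simp flip: div_less_iff_less_mult simp del: mult_Suc mult_Suc_right)
qed simp

text \<open>Nonempty blocks of positive parts have positive sums, and merging blocks keeps the
  total. This makes the endomorphism graded.\<close>

lemma factorizations_compositions:
  assumes "xss \<in> factorizations \<alpha>" "\<alpha> \<in> compositions n"
  shows "map sum_list xss \<in> compositions n"
proof -
  have "sum_list xs \<noteq> 0" if "xs \<in> set xss" for xs
  proof -
    have "xs \<noteq> []" "0 \<notin> set xs" using that assms by (auto simp: factorizations_def compositions_def)
    then show ?thesis by (cases xs) auto
  qed
  moreover have "sum_list (concat xss) = sum_list (map sum_list xss)"
    by (induction xss) auto
  then have "sum_list (map sum_list xss) = n"
    using assms by (auto simp: factorizations_def compositions_def)
  ultimately show ?thesis by (force simp: compositions_def)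
qed

text \<open>The support of \<open>m\<close> lies below some \<open>J\<close>, so only variables with
  index below \<open>J * Suc N\<close> matter and \<open>M_\<alpha>\<close> can be replaced by a
  polynomial. There the substitution, a ring homomorphism, reduces to
  \<open>qs_poly_blocks\<close>.\<close>

lemma mcoeff_block_subst_qs_M:
  assumes "0 \<notin> set \<alpha>"
  shows "mcoeff (block_subst r N (qs_M \<alpha>)) m = (\<Sum>xss\<in>factorizations \<alpha>.
    (\<Prod>xs\<leftarrow>xss. qs_poly r xs 0 (Suc N)) * mcoeff (qs_M (map sum_list xss)) m)"
proof -
  let ?h = "\<lambda>k. k div Suc N"
  have "finite (set_mset m)" by simp
  then obtain J where J: "set_mset m \<subseteq> {0..<J}"
    by (metis atLeast0LessThan finite_nat_iff_bounded)
  have pos: "0 \<notin> set (map sum_list xss)" if "xss \<in> factorizations \<alpha>" for xss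
    using factorizations_compositions[OF that, of "sum_list \<alpha>"] assms
    by (auto simp: compositions_def)
  have "mcoeff (block_subst r N (qs_M \<alpha>)) m =
      mcoeff (block_subst r N (qs_poly var \<alpha> 0 (J * Suc N))) m"
    unfolding block_subst_def mcoeff_msubst
  proof (rule sum.cong[OF refl])
    fix M assume "M \<in> {M. image_mset ?h M = m}"
    then have "set_mset M \<subseteq> {0..<J * Suc N}"
      using J by (auto simp: image_subset_iff simp flip: div_less_iff_less_mult simp del: mult_Suc_right)
    then show "mcoeff (qs_M \<alpha>) M * (\<Prod>i\<in>#M. r (i mod Suc N)) =
        mcoeff (qs_poly var \<alpha> 0 (J * Suc N)) M * (\<Prod>i\<in>#M. r (i mod Suc N))"
      using assms by (simp add: mcoeff_qs_M mcoeff_qs_poly_var)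
  qed
  also have "block_subst r N (qs_poly var \<alpha> 0 (J * Suc N)) =
      qs_poly (\<lambda>k. r (k mod Suc N) *\<^sub>R var (?h k)) \<alpha> (0 * Suc N) (J * Suc N)"
    unfolding block_subst_def
    by (subst qs_poly_hom)
      (simp_all add: msubst_add msubst_one msubst_mult msubst_var finite_vimage_div_Suc)
  also have "\<dots> = (\<Sum>xss\<in>factorizations \<alpha>.
      (\<Prod>xs\<leftarrow>xss. qs_poly r xs 0 (Suc N)) *\<^sub>R qs_poly var (map sum_list xss) 0 J)"
    by (rule qs_poly_blocks) auto
  also have "mcoeff \<dots> m = (\<Sum>xss\<in>factorizations \<alpha>.
      (\<Prod>xs\<leftarrow>xss. qs_poly r xs 0 (Suc N)) * mcoeff (qs_M (map sum_list xss)) m)"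
    unfolding mcoeff_sum mcoeff_scaleR
    by (intro sum.cong refl arg_cong2[where f = times])
      (use pos J in \<open>simp add: mcoeff_qs_poly_var mcoeff_qs_M\<close>)
  finally show ?thesis .
qed


section \<open>The endomorphism\<close>

definition homogeneous_monomials :: "nat \<Rightarrow> nat \<Rightarrow> nat multiset set" where
  "homogeneous_monomials n N = {m. size m = n \<and> set_mset m \<subseteq> {..<N}}"

lemma finite_homogeneous_monomials: "finite (homogeneous_monomials n N)"
proof (rule finite_subset)
  show "homogeneous_monomials n N \<subseteq> mset ` {xs. set xs \<subseteq> {..<N} \<and> length xs = n}"
  proof
    fix m assume "m \<in> homogeneous_monomials n N"
    moreover obtain xs where "m = mset xs" by (metis ex_mset)
    ultimately show "m \<in> mset ` {xs. set xs \<subseteq> {..<N} \<and> length xs = n}"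
      by (auto simp: homogeneous_monomials_def)
  qed
  show "finite (mset ` {xs. set xs \<subseteq> {..<N} \<and> length xs = n})"
    by (intro finite_imageI finite_lists_length_eq) auto
qed

text \<open>The limits exist on \<^const>\<open>QSym\<close>; elsewhere the coefficients are arbitrary.\<close>

definition specialisation_endo :: "(nat \<Rightarrow> real) \<Rightarrow> nat mseries \<Rightarrow> nat mseries" where
  "specialisation_endo r f = MSeries (\<lambda>m. lim (\<lambda>N. mcoeff (block_subst r N f) m))"

lemma tendsto_prod_list:
  fixes f :: "'a \<Rightarrow> nat \<Rightarrow> real"
  assumes "\<And>x. x \<in> set xs \<Longrightarrow> f x \<longlonglongrightarrow> g x"
  shows "(\<lambda>N. \<Prod>x\<leftarrow>xs. f x N) \<longlonglongrightarrow> (\<Prod>x\<leftarrow>xs. g x)"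
  using assms by (induction xs) (auto intro!: tendsto_mult)

locale probability_sequence =
  fixes r :: "nat \<Rightarrow> real"
  assumes nonneg: "r i \<ge> 0" and sums_1: "r sums 1"
begin

section \<open>Convergence of the truncated values and substitutions\<close>

lemma sum_le_1: "finite A \<Longrightarrow> sum r A \<le> 1"
  using sum_le_suminf[of r A] sums_1 nonneg by (auto simp: sums_iff)

lemma qs_poly_nonneg: "qs_poly r \<alpha> s t \<ge> 0"
  by (induction \<alpha> arbitrary: s) (auto intro!: sum_nonneg mult_nonneg_nonneg zero_le_power nonneg)

text \<open>Since \<open>r i \<le> 1\<close> and the parts are positive,
  \<open>r i ^ a \<le> r i\<close>, and the \<open>r i\<close> sum to at most 1. With monotonicity
  in \<open>t\<close> this bound gives convergence.\<close>

lemma qs_poly_le_1: "0 \<notin> set \<alpha> \<Longrightarrow> qs_poly r \<alpha> s t \<le> 1"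
proof (induction \<alpha> arbitrary: s)
  case (Cons a \<alpha>)
  have "qs_poly r (a # \<alpha>) s t \<le> (\<Sum>i\<in>{s..<t}. r i * 1)"
    unfolding qs_poly.simps
  proof (intro sum_mono mult_mono)
    fix i
    have "r i \<le> 1" using sum_le_1[of "{i}"] by simp
    then show "r i ^ a \<le> r i"
      using Cons.prems nonneg[of i] power_decreasing[of 1 a "r i"] by (auto simp: Suc_le_eq)
  qed (use Cons nonneg qs_poly_nonneg in auto)
  also have "\<dots> \<le> 1" using sum_le_1 by simp
  finally show ?case .
qed simp

lemma qs_poly_mono: "t \<le> u \<Longrightarrow> qs_poly r \<alpha> s t \<le> qs_poly r \<alpha> s u"
proof (induction \<alpha> arbitrary: s)
  case (Cons a \<alpha>)
  have "qs_poly r (a # \<alpha>) s t \<le> (\<Sum>i\<in>{s..<t}. r i ^ a * qs_poly r \<alpha> (Suc i) u)"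
    using Cons by (auto intro!: sum_mono mult_left_mono simp: nonneg)
  also have "\<dots> \<le> qs_poly r (a # \<alpha>) s u"
    unfolding qs_poly.simps using Cons.prems
    by (intro sum_mono2) (auto intro!: mult_nonneg_nonneg qs_poly_nonneg simp: nonneg)
  finally show ?case .
qed simp

text \<open>The value \<open>M_\<alpha>(r)\<close>, as the limit over the initial segments of
  \<open>r\<close>.\<close>

definition character :: "nat list \<Rightarrow> real" where
  "character \<alpha> = lim (\<lambda>N. qs_poly r \<alpha> 0 (Suc N))"

lemma qs_poly_tendsto_character:
  assumes "0 \<notin> set \<alpha>"
  shows "(\<lambda>N. qs_poly r \<alpha> 0 (Suc N)) \<longlonglongrightarrow> character \<alpha>"
proof -
  have "incseq (\<lambda>N. qs_poly r \<alpha> 0 (Suc N))"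
    by (auto intro!: incseq_SucI qs_poly_mono)
  then obtain L where "(\<lambda>N. qs_poly r \<alpha> 0 (Suc N)) \<longlonglongrightarrow> L"
    using incseq_convergent qs_poly_le_1[OF assms] by metis
  then show ?thesis by (auto simp: character_def dest: limI)
qed

definition weight :: "nat list list \<Rightarrow> real" where
  "weight xss = (\<Prod>xs\<leftarrow>xss. character xs)"

lemma weight_append: "weight (xss @ yss) = weight xss * weight yss"
  by (simp add: weight_def)

text \<open>The index set \<open>factorizations \<alpha>\<close> is finite and does not depend on
  \<open>N\<close>, so the limit is taken term by term.\<close>

lemma block_subst_qs_M_tendsto:
  assumes "\<alpha> \<in> all_compositions"
  shows "(\<lambda>N. mcoeff (block_subst r N (qs_M \<alpha>)) m) \<longlonglongrightarrow>
    mcoeff (\<Sum>xss\<in>factorizations \<alpha>. weight xss *\<^sub>R qs_M (map sum_list xss)) m"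
proof -
  have "0 \<notin> set xs" if "xss \<in> factorizations \<alpha>" "xs \<in> set xss" for xss xs
    using that assms by (auto simp: factorizations_def all_compositions_eq)
  then show ?thesis
    using assms unfolding weight_def mcoeff_sum mcoeff_scaleR
    by (auto simp: mcoeff_block_subst_qs_M all_compositions_eq
        intro!: tendsto_sum tendsto_mult tendsto_const tendsto_prod_list qs_poly_tendsto_character)
qed

text \<open>The series whose coefficients converge form a subspace, and it contains the
  \<open>qs_M\<close>.\<close>

lemma block_subst_tendsto:
  assumes "f \<in> QSym"
  shows "(\<lambda>N. mcoeff (block_subst r N f) m) \<longlonglongrightarrow> mcoeff (specialisation_endo r f) m"
proof -
  have "QSym \<subseteq> {f. \<forall>m. convergent (\<lambda>N. mcoeff (block_subst r N f) m)}"
    unfolding QSym_eq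
  proof (rule span_minimal)
    show "qs_M ` all_compositions \<subseteq> {f. \<forall>m. convergent (\<lambda>N. mcoeff (block_subst r N f) m)}"
      using block_subst_qs_M_tendsto by (auto simp: convergent_def)
    show "subspace {f. \<forall>m. convergent (\<lambda>N. mcoeff (block_subst r N f) m)}"
      by (auto simp: subspace_def block_subst_def msubst_add msubst_scaleR
          intro!: convergent_add convergent_const convergent_mult)
  qed
  then show ?thesis
    using assms by (auto simp: specialisation_endo_def convergent_LIMSEQ_iff)
qed

lemma specialisation_endo_eqI:
  assumes "f \<in> QSym" "\<And>m. (\<lambda>N. mcoeff (block_subst r N f) m) \<longlonglongrightarrow> mcoeff g m"
  shows "specialisation_endo r f = g"
  by (rule mseries_eqI) (use LIMSEQ_unique[OF block_subst_tendsto[OF assms(1)] assms(2)] in auto)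

lemma specialisation_endo_linear_on_QSym:
  assumes "f \<in> QSym" "g \<in> QSym"
  shows "specialisation_endo r (f + g) = specialisation_endo r f + specialisation_endo r g"
    and "specialisation_endo r (c *\<^sub>R f) = c *\<^sub>R specialisation_endo r f"
proof -
  show "specialisation_endo r (f + g) = specialisation_endo r f + specialisation_endo r g"
    using tendsto_add[OF block_subst_tendsto[OF assms(1)] block_subst_tendsto[OF assms(2)]]
    by (intro specialisation_endo_eqI)
      (auto simp: block_subst_def msubst_add intro: subspace_add[OF subspace_QSym] assms)
  show "specialisation_endo r (c *\<^sub>R f) = c *\<^sub>R specialisation_endo r f"
    using tendsto_mult[OF tendsto_const block_subst_tendsto[OF assms(1)]]
    by (intro specialisation_endo_eqI)
      (auto simp: block_subst_def msubst_scaleR intro: subspace_scale[OF subspace_QSym] assms)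
qed

text \<open>Every truncation is multiplicative, and a coefficient of a product is a finite sum of
  products of coefficients, so multiplicativity survives the limit.\<close>

lemma specialisation_endo_mult:
  assumes "f \<in> QSym" "g \<in> QSym"
  shows "specialisation_endo r (f * g) = specialisation_endo r f * specialisation_endo r g"
proof (rule mseries_eqI)
  fix m
  have "(\<lambda>N. mcoeff (block_subst r N (f * g)) m) \<longlonglongrightarrow>
      mcoeff (specialisation_endo r f * specialisation_endo r g) m"
    unfolding block_subst_def msubst_mult[OF finite_vimage_div_Suc]
    unfolding mcoeff_times block_subst_def[symmetric]
    by (intro tendsto_sum tendsto_mult block_subst_tendsto assms)
  then show "mcoeff (specialisation_endo r (f * g)) m =
      mcoeff (specialisation_endo r f * specialisation_endo r g) m"
    by (simp add: specialisation_endo_def limI)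
qed

lemma specialisation_endo_one: "specialisation_endo r 1 = 1"
  by (rule specialisation_endo_eqI)
    (auto simp: one_in_QSym block_subst_def msubst_one[OF finite_vimage_div_Suc])

lemma counit_specialisation_endo: "counit (specialisation_endo r f) = counit f"
  by (simp add: counit_def specialisation_endo_def block_subst_def mcoeff_msubst_empty)

lemma specialisation_endo_qs_M:
  assumes "\<alpha> \<in> all_compositions"
  shows "specialisation_endo r (qs_M \<alpha>) =
    (\<Sum>xss\<in>factorizations \<alpha>. weight xss *\<^sub>R qs_M (map sum_list xss))"
  by (rule specialisation_endo_eqI[OF qs_M_in_QSym[OF assms] block_subst_qs_M_tendsto[OF assms]])

text \<open>The limits behave linearly on \<open>QSym\<close>; replacing the map by one that is
  linear on all series allows arguments by comparing linear maps on a span.\<close>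

lemma ex_linear_specialisation_endo:
  "\<exists>P. linear P \<and> (\<forall>f\<in>QSym. P f = specialisation_endo r f)"
proof -
  obtain P where P: "linear P" "\<And>b. b \<in> qs_M ` all_compositions \<Longrightarrow> P b = specialisation_endo r b"
    using linear_independent_extend[OF qs_M_independent] by metis
  interpret P: linear P by fact
  \<comment> \<open>The set of agreement is a subspace; the scaling rule at \<open>c = 0\<close>
    supplies its zero vector.\<close>
  have "QSym \<subseteq> {f \<in> QSym. P f = specialisation_endo r f}"
    using specialisation_endo_linear_on_QSym(2)[OF one_in_QSym one_in_QSym, of 0]
    by (subst QSym_eq, intro span_minimal)
      (auto simp: P qs_M_in_QSym subspace_def P.zero P.add P.scale specialisation_endo_linear_on_QSym
        subspace_0[OF subspace_QSym] subspace_add[OF subspace_QSym] subspace_scale[OF subspace_QSym])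
  with P(1) show ?thesis by blast
qed

text \<open>Cutting \<open>\<alpha>\<close> into blocks and then splitting the list of blocks in two
  is the same as splitting \<open>\<alpha>\<close> first and cutting both halves;
  \<open>weight\<close> is multiplicative along this.\<close>

lemma specialisation_endo_coalgebra:
  assumes P: "linear P" "\<And>f. f \<in> QSym \<Longrightarrow> P f = specialisation_endo r f"
  shows "\<exists>T. linear T \<and> (\<forall>f\<in>QSym. \<forall>g\<in>QSym. T (tensor f g) = tensor (P f) (P g)) \<and>
    (\<forall>f\<in>QSym. coproduct (P f) = T (coproduct f))"
proof -
  define \<tau> where "\<tau> = (\<lambda>(\<beta>, \<gamma>). tensor (P (qs_M \<beta>)) (P (qs_M \<gamma>)))"
  \<comment> \<open>\<open>T\<close> is prescribed on the independent tensors
    \<open>tensor_M\<close> and extended linearly; the next steps pass to arbitrary tensors one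
    argument at a time.\<close>
  obtain T where T: "linear T" "\<forall>b\<in>tensor_M ` (all_compositions \<times> all_compositions).
      T b = \<tau> (the_inv_into (all_compositions \<times> all_compositions) tensor_M b)"
    using linear_independent_extend[OF tensor_M_independent,
        of "\<lambda>b. \<tau> (the_inv_into (all_compositions \<times> all_compositions) tensor_M b)"]
    by (elim exE conjE)
  interpret T: linear T by fact
  interpret P: linear P by fact
  interpret C: linear coproduct by (rule linear_coproduct)
  have lin_l: "linear (\<lambda>f. tensor f g)" and lin_r: "linear (tensor f)" for f g :: "nat mseries"
    using bilinear_tensor by (auto simp: bilinear_def)
  have T_M: "T (tensor (qs_M \<beta>) (qs_M \<gamma>)) = tensor (P (qs_M \<beta>)) (P (qs_M \<gamma>))"
    if "\<beta> \<in> all_compositions" "\<gamma> \<in> all_compositions" for \<beta> \<gamma>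
    using T(2)[rule_format, of "tensor_M (\<beta>, \<gamma>)"] that
    by (simp add: the_inv_into_f_f[OF tensor_M_inj]) (simp add: tensor_M_def \<tau>_def)
  have T_M_l: "T (tensor f (qs_M \<gamma>)) = tensor (P f) (P (qs_M \<gamma>))"
    if "f \<in> QSym" "\<gamma> \<in> all_compositions" for f \<gamma>
  proof (rule linear_eq_on_span[where f = "\<lambda>f. T (tensor f (qs_M \<gamma>))"])
    show "linear (\<lambda>f. T (tensor f (qs_M \<gamma>)))" "linear (\<lambda>f. tensor (P f) (P (qs_M \<gamma>)))"
      using linear_compose[OF lin_l T(1)] linear_compose[OF P(1) lin_l] by (simp_all add: comp_def)
  qed (use that T_M in \<open>auto simp: QSym_eq\<close>)
  have T_tensor: "T (tensor f g) = tensor (P f) (P g)" if "f \<in> QSym" "g \<in> QSym" for f g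
  proof (rule linear_eq_on_span[where f = "\<lambda>g. T (tensor f g)"])
    show "linear (\<lambda>g. T (tensor f g))" "linear (\<lambda>g. tensor (P f) (P g))"
      using linear_compose[OF lin_r T(1)] linear_compose[OF P(1) lin_r] by (simp_all add: comp_def)
  qed (use that T_M_l in \<open>auto simp: QSym_eq\<close>)
  have P_M: "P (qs_M \<alpha>) = (\<Sum>xss\<in>factorizations \<alpha>. weight xss *\<^sub>R qs_M (map sum_list xss))"
    if "\<alpha> \<in> all_compositions" for \<alpha>
    using that by (simp add: P(2) qs_M_in_QSym specialisation_endo_qs_M)
  let ?t = "\<lambda>yss zss. tensor (qs_M (map sum_list yss)) (qs_M (map sum_list zss))"
  have "coproduct (P (qs_M \<alpha>)) = T (coproduct (qs_M \<alpha>))" if \<alpha>: "\<alpha> \<in> all_compositions" for \<alpha>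
  proof -
    have comp: "map sum_list xss \<in> all_compositions" if "xss \<in> factorizations \<alpha>" for xss
      using factorizations_compositions[OF that] \<alpha> by (auto simp: all_compositions_def)
    have "coproduct (P (qs_M \<alpha>)) = (\<Sum>xss\<in>factorizations \<alpha>. weight xss *\<^sub>R
        (\<Sum>(\<delta>, \<epsilon>) | \<delta> @ \<epsilon> = map sum_list xss. tensor (qs_M \<delta>) (qs_M \<epsilon>)))"
      using comp by (simp add: P_M[OF \<alpha>] C.sum C.scale coproduct_qs_M)
    \<comment> \<open>Every splitting of the list of block sums comes from exactly one splitting of
      the list of blocks, at the same length.\<close>
    also have "\<dots> = (\<Sum>xss\<in>factorizations \<alpha>. weight xss *\<^sub>R (\<Sum>(yss, zss) | yss @ zss = xss. ?t yss zss))"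
    proof (intro sum.cong refl arg_cong2[where f = scaleR])
      fix xss
      show "(\<Sum>(\<delta>, \<epsilon>) | \<delta> @ \<epsilon> = map sum_list xss. tensor (qs_M \<delta>) (qs_M \<epsilon>)) =
          (\<Sum>(yss, zss) | yss @ zss = xss. ?t yss zss)"
        by (rule sum.reindex_bij_witness[of _ "\<lambda>(yss, zss). (map sum_list yss, map sum_list zss)"
              "\<lambda>(\<delta>, \<epsilon>). (take (length \<delta>) xss, drop (length \<delta>) xss)"])
          (auto simp: take_map[symmetric] drop_map[symmetric] dest: sym)
    qed
    also have "\<dots> = (\<Sum>xss\<in>factorizations \<alpha>. \<Sum>(yss, zss) | yss @ zss = xss.
        (weight yss * weight zss) *\<^sub>R ?t yss zss)"
      by (auto simp: scaleR_sum_right weight_append case_prod_unfold intro!: sum.cong)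
    also have "\<dots> = (\<Sum>(xss, yss, zss)\<in>(SIGMA xss:factorizations \<alpha>. {(yss, zss). yss @ zss = xss}).
        (weight yss * weight zss) *\<^sub>R ?t yss zss)"
      by (subst sum.Sigma)
        (auto simp: finite_factorizations finite_splits[unfolded case_prod_unfold] case_prod_unfold)
    \<comment> \<open>Regrouping by \<open>\<beta> = concat yss\<close> and
      \<open>\<gamma> = concat zss\<close>; a cut between two blocks is also a cut of
      \<open>\<alpha>\<close>.\<close>
    also have "\<dots> = (\<Sum>((\<beta>, \<gamma>), yss, zss)\<in>(SIGMA (\<beta>, \<gamma>):{(\<beta>, \<gamma>). \<beta> @ \<gamma> = \<alpha>}.
        factorizations \<beta> \<times> factorizations \<gamma>). (weight yss * weight zss) *\<^sub>R ?t yss zss)"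
      by (rule sum.reindex_bij_witness[of _ "\<lambda>(_, yss, zss). (yss @ zss, yss, zss)"
            "\<lambda>(_, yss, zss). ((concat yss, concat zss), yss, zss)"])
        (auto simp: factorizations_def)
    also have "\<dots> = (\<Sum>(\<beta>, \<gamma>) | \<beta> @ \<gamma> = \<alpha>. \<Sum>(yss, zss)\<in>factorizations \<beta> \<times> factorizations \<gamma>.
        (weight yss * weight zss) *\<^sub>R ?t yss zss)"
      by (subst sum.Sigma[symmetric])
        (auto simp: finite_factorizations finite_splits[unfolded case_prod_unfold] case_prod_unfold)
    also have "\<dots> = (\<Sum>(\<beta>, \<gamma>) | \<beta> @ \<gamma> = \<alpha>. tensor (P (qs_M \<beta>)) (P (qs_M \<gamma>)))"
    proof (rule sum.cong[OF refl], clarify)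
      fix \<beta> \<gamma> assume "\<alpha> = \<beta> @ \<gamma>"
      then have "\<beta> \<in> all_compositions" "\<gamma> \<in> all_compositions" using \<alpha> by (auto simp: all_compositions_eq)
      then show "(\<Sum>(yss, zss)\<in>factorizations \<beta> \<times> factorizations \<gamma>.
          (weight yss * weight zss) *\<^sub>R ?t yss zss) = tensor (P (qs_M \<beta>)) (P (qs_M \<gamma>))"
        by (simp add: P_M bilinear_sum[OF bilinear_tensor] finite_factorizations case_prod_unfold
            bilinear_lmul[OF bilinear_tensor] bilinear_rmul[OF bilinear_tensor] mult.commute)
    qed
    also have "\<dots> = T (coproduct (qs_M \<alpha>))"
      using \<alpha> by (auto simp: coproduct_qs_M T.sum case_prod_unfold T_tensor qs_M_in_QSym
          all_compositions_eq intro!: sum.cong)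
    finally show ?thesis .
  qed
  then have "coproduct (P f) = T (coproduct f)" if "f \<in> QSym" for f
    using linear_eq_on_span[of "\<lambda>f. coproduct (P f)" "\<lambda>f. T (coproduct f)"]
      linear_compose[OF P(1) linear_coproduct] linear_compose[OF linear_coproduct T(1)] that
    unfolding QSym_eq comp_def by blast
  with T(1) T_tensor show ?thesis by blast
qed

lemma specialisation_endo_hopf: "specialisation_endo r \<in> hopf_endomorphisms"
proof -
  obtain P where P: "linear P" "\<And>f. f \<in> QSym \<Longrightarrow> P f = specialisation_endo r f"
    using ex_linear_specialisation_endo by blast
  have deg: "QSym_deg n \<subseteq> QSym" for n
    unfolding QSym_eq QSym_deg_def by (auto intro!: span_mono simp: all_compositions_def)
  have "P (qs_M \<alpha>) \<in> QSym_deg n" if "\<alpha> \<in> compositions n" for \<alpha> n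
  proof -
    have "\<alpha> \<in> all_compositions" using that by (auto simp: all_compositions_def)
    then show ?thesis using that
      by (simp add: P(2) qs_M_in_QSym specialisation_endo_qs_M QSym_deg_def
          span_sum span_scale span_base factorizations_compositions)
  qed
  then have "P ` QSym_deg n \<subseteq> QSym_deg n" for n
    unfolding QSym_deg_def linear_span_image[OF P(1), symmetric] image_image
    by (intro span_minimal) auto
  then have "specialisation_endo r ` QSym_deg n \<subseteq> QSym_deg n" for n
    using P(2) deg by (metis (no_types, lifting) image_cong subsetD)
  moreover obtain T where "linear T" "\<And>f g. f \<in> QSym \<Longrightarrow> g \<in> QSym \<Longrightarrow> T (tensor f g) = tensor (P f) (P g)"
    "\<And>f. f \<in> QSym \<Longrightarrow> coproduct (P f) = T (coproduct f)"
    using specialisation_endo_coalgebra[OF P] by blast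
  ultimately show ?thesis
    unfolding hopf_endomorphisms_def
    by (auto simp: specialisation_endo_linear_on_QSym specialisation_endo_mult
        specialisation_endo_one counit_specialisation_endo P(2) intro!: exI[of _ T])
qed

end


section \<open>The fundamental basis\<close>

lemma partial_sums_Nil [simp]: "partial_sums [] = {}"
  by (auto simp: partial_sums_def)

lemma partial_sums_single [simp]: "partial_sums [a] = {}"
  by (auto simp: partial_sums_def)

lemma partial_sums_Cons:
  assumes "\<alpha> \<noteq> []"
  shows "partial_sums (a # \<alpha>) = insert a ((+) a ` partial_sums \<alpha>)"
proof (intro equalityI subsetI)
  fix k assume "k \<in> partial_sums (a # \<alpha>)"
  then obtain j where j: "k = sum_list (take j (a # \<alpha>))" "1 \<le> j" "j < length (a # \<alpha>)"
    by (auto simp: partial_sums_def)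
  then obtain i where i: "j = Suc i" by (cases j) auto
  show "k \<in> insert a ((+) a ` partial_sums \<alpha>)"
    using j by (cases i) (auto simp: i partial_sums_def)
next
  fix k assume "k \<in> insert a ((+) a ` partial_sums \<alpha>)"
  then consider "k = a" | i where "k = a + sum_list (take i \<alpha>)" "1 \<le> i" "i < length \<alpha>"
    by (auto simp: partial_sums_def)
  then show "k \<in> partial_sums (a # \<alpha>)"
  proof cases
    case 1
    then have "k = sum_list (take 1 (a # \<alpha>))" by simp
    then show ?thesis using assms unfolding partial_sums_def by fastforce
  next
    case 2
    then have "k = sum_list (take (Suc i) (a # \<alpha>))" by simp
    then show ?thesis using 2 unfolding partial_sums_def by fastforce
  qed
qed

lemma partial_sums_subset:
  assumes "\<alpha> \<in> compositions n"
  shows "partial_sums \<alpha> \<subseteq> {1..<n}"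
  using assms
proof (induction \<alpha> arbitrary: n)
  case (Cons a \<alpha>)
  then have "partial_sums \<alpha> \<subseteq> {1..<n - a}" "a > 0" "a \<le> n" by (auto simp: compositions_def)
  moreover have "a < n" if "\<alpha> \<noteq> []" using that Cons.prems by (cases \<alpha>) (auto simp: compositions_def)
  ultimately show ?case
    by (cases "\<alpha> = []") (auto simp: partial_sums_Cons dest!: subsetD)
qed auto

text \<open>The least partial sum is the first part, and the others, shifted down by it, are the
  partial sums of the tail.\<close>

lemma partial_sums_inj: "inj_on partial_sums (compositions n)"
proof -
  have "\<alpha> = \<beta>" if "\<alpha> \<in> compositions n" "\<beta> \<in> compositions n" "partial_sums \<alpha> = partial_sums \<beta>" for \<alpha> \<beta>
    using that
  proof (induction \<alpha> arbitrary: n \<beta>)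
    case Nil
    then show ?case by (cases \<beta>) (auto simp: compositions_def)
  next
    case (Cons a \<alpha>)
    then obtain b \<gamma> where \<beta>: "\<beta> = b # \<gamma>" by (cases \<beta>) (auto simp: compositions_def)
    show ?case
    proof (cases "\<alpha> = [] \<or> \<gamma> = []")
      case True
      then have "\<alpha> = []" "\<gamma> = []"
        using Cons.prems(3) by (auto simp: \<beta> partial_sums_Cons split: if_splits)
          (metis insert_not_empty partial_sums_Cons)+
      then show ?thesis using Cons.prems by (simp add: \<beta> compositions_def)
    next
      case False
      have *: "\<alpha> \<in> compositions (n - a)" "\<gamma> \<in> compositions (n - b)"
        using Cons.prems by (auto simp: \<beta> compositions_def)
      have Min: "Min (insert c ((+) c ` partial_sums \<delta>)) = c" if "\<delta> \<in> compositions k" for c k \<delta>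
        using finite_subset[OF partial_sums_subset[OF that]] by (intro Min_eqI) auto
      have eq: "insert a ((+) a ` partial_sums \<alpha>) = insert b ((+) b ` partial_sums \<gamma>)"
        using Cons.prems False by (simp add: \<beta> partial_sums_Cons)
      then have "a = b" using Min[OF *(1)] Min[OF *(2)] by metis
      have "a \<notin> (+) a ` partial_sums \<delta>" if "\<delta> \<in> compositions k" for k \<delta>
        using partial_sums_subset[OF that] by auto
      then have "(+) a ` partial_sums \<alpha> = (+) a ` partial_sums \<gamma>"
        using eq * unfolding \<open>a = b\<close> by (metis insert_ident)
      then have "partial_sums \<alpha> = partial_sums \<gamma>" by (simp add: inj_image_eq_iff)
      then show ?thesis using Cons.IH[OF *(1), of \<gamma>] * \<open>a = b\<close> by (simp add: \<beta>)
    qed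
  qed
  then show ?thesis by (auto simp: inj_on_def)
qed

text \<open>The same recursion backwards: the least element of \<open>S\<close> becomes the first
  part.\<close>

lemma partial_sums_surj:
  assumes "S \<subseteq> {1..<n}"
  shows "\<exists>\<alpha>\<in>compositions n. partial_sums \<alpha> = S"
  using assms
proof (induction n arbitrary: S rule: less_induct)
  case (less n)
  have "finite S" using less.prems by (rule finite_subset) simp
  show ?case
  proof (cases "S = {}")
    case True
    then show ?thesis
      by (intro bexI[of _ "one_part n"]) (auto simp: one_part_def compositions_def)
  next
    case False
    define a where "a = Min S"
    have a: "a \<in> S" "\<And>x. x \<in> S \<Longrightarrow> a \<le> x" using False \<open>finite S\<close> by (auto simp: a_def)
    then have "0 < a" "a < n" using less.prems by auto
    let ?S = "(\<lambda>x. x - a) ` (S - {a})"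
    have "?S \<subseteq> {1..<n - a}" using a less.prems by force
    then obtain \<beta> where \<beta>: "\<beta> \<in> compositions (n - a)" "partial_sums \<beta> = ?S"
      using less.IH[of "n - a" ?S] \<open>0 < a\<close> \<open>a < n\<close> by auto
    have "\<beta> \<noteq> []" using \<beta>(1) \<open>a < n\<close> by (auto simp: compositions_def)
    moreover have "(+) a ` ?S = S - {a}"
      unfolding image_image using a(2) by (auto simp: image_iff)
    ultimately have "partial_sums (a # \<beta>) = S" using a(1) \<beta> by (auto simp: partial_sums_Cons)
    then show ?thesis
      using \<beta> \<open>0 < a\<close> \<open>a < n\<close> by (intro bexI[of _ "a # \<beta>"]) (auto simp: compositions_def)
  qed
qed

lemma finite_compositions: "finite (compositions n)"
  by (rule finite_imageD[OF _ partial_sums_inj], rule finite_subset[of _ "Pow {1..<n}"])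
    (use partial_sums_subset in blast)+

lemma co_properties:
  assumes "S \<subseteq> {1..<n}"
  shows "co n S \<in> compositions n" "partial_sums (co n S) = S"
proof -
  obtain \<alpha> where \<alpha>: "\<alpha> \<in> compositions n" "partial_sums \<alpha> = S"
    using partial_sums_surj[OF assms] by blast
  then have "co n S = \<alpha>" unfolding co_def by (metis the_inv_into_f_f[OF partial_sums_inj])
  then show "co n S \<in> compositions n" "partial_sums (co n S) = S" using \<alpha> by auto
qed

section \<open>Descent sets, and coefficients with respect to the fundamental basis\<close>

definition descents :: "nat \<Rightarrow> (nat \<Rightarrow> nat) \<Rightarrow> nat set" where
  "descents n \<sigma> = {i. 1 \<le> i \<and> i < n \<and> \<sigma> i > \<sigma> (i + 1)}"

lemma descent_comp_properties:
  "descent_comp n \<sigma> \<in> compositions n" "partial_sums (descent_comp n \<sigma>) = descents n \<sigma>"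
  unfolding descent_comp_def descents_def by (rule co_properties; auto)+

lemma exponents_in_compositions: "exponents m \<in> compositions (size m)"
  by (simp add: compositions_def exponents_nonzero)

text \<open>The monomial \<open>m\<close> occurs only in the summand \<open>M_\<beta>\<close> with
  \<open>\<beta> = exponents m\<close>, so the sum over \<open>\<beta> \<ge> \<alpha>\<close>
  becomes a single test.\<close>

lemma mcoeff_qs_F:
  assumes "\<alpha> \<in> compositions n"
  shows "mcoeff (qs_F \<alpha>) m = of_bool (size m = n \<and> partial_sums \<alpha> \<subseteq> partial_sums (exponents m))"
proof -
  have n: "sum_list \<alpha> = n" using assms by (simp add: compositions_def)
  let ?B = "{\<beta>. \<beta> \<in> compositions n \<and> comp_le \<alpha> \<beta>}"
  have "mcoeff (qs_F \<alpha>) m = (\<Sum>\<beta>\<in>?B. if exponents m = \<beta> then 1 else 0)"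
    unfolding qs_F_def n mcoeff_sum
    by (rule sum.cong) (auto simp: mcoeff_qs_M compositions_def of_bool_def)
  also have "\<dots> = of_bool (exponents m \<in> ?B)"
    using finite_compositions by (simp add: of_bool_def)
  also have "exponents m \<in> ?B \<longleftrightarrow> size m = n \<and> partial_sums \<alpha> \<subseteq> partial_sums (exponents m)"
    using exponents_in_compositions[of m] n by (auto simp: comp_le_def compositions_def)
  finally show ?thesis .
qed

lemma exponents_replicate: "exponents (replicate_mset n x) = one_part n"
  by (cases "n = 0") (auto simp: exponents_def one_part_def)

lemma one_part_in_compositions: "one_part n \<in> compositions n"
  by (auto simp: one_part_def compositions_def)

lemma partial_sums_one_part [simp]: "partial_sums (one_part n) = {}"
  by (simp add: one_part_def)

text \<open>The coefficient of \<open>M_\<alpha>\<close> in \<open>F_\<beta>\<close> vanishes unless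
  \<open>\<beta> \<le> \<alpha>\<close>, so the family is triangular with the number of partial sums
  as rank.\<close>

lemma qs_F_independent: "independent (qs_F ` all_compositions)"
  and qs_F_inj: "inj_on qs_F all_compositions"
proof -
  define e where "e = (\<lambda>\<alpha> f. mcoeff f (SOME m. exponents m = \<alpha>))"
  have e: "e \<alpha> (qs_F \<beta>) = of_bool (sum_list \<alpha> = sum_list \<beta> \<and> partial_sums \<beta> \<subseteq> partial_sums \<alpha>)"
    if "\<alpha> \<in> all_compositions" "\<beta> \<in> all_compositions" for \<alpha> \<beta>
  proof -
    have "exponents (SOME m. exponents m = \<alpha>) = \<alpha>"
      using someI_ex[OF ex_exponents_eq, of \<alpha>] that by (auto simp: all_compositions_eq)
    moreover from this have "size (SOME m. exponents m = \<alpha>) = sum_list \<alpha>"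
      by (metis sum_list_exponents)
    ultimately show ?thesis
      using mcoeff_qs_F[of \<beta> "sum_list \<beta>"] that by (simp add: e_def all_compositions_eq compositions_def)
  qed
  have lin: "linear (e \<alpha>)" for \<alpha> by (simp add: e_def linear_mcoeff)
  have tri: "\<beta> = \<alpha> \<or> card (partial_sums \<beta>) < card (partial_sums \<alpha>)"
    if "\<alpha> \<in> all_compositions" "\<beta> \<in> all_compositions" "e \<alpha> (qs_F \<beta>) \<noteq> 0" for \<alpha> \<beta>
  proof -
    have *: "\<alpha> \<in> compositions (sum_list \<alpha>)" "\<beta> \<in> compositions (sum_list \<alpha>)"
      "partial_sums \<beta> \<subseteq> partial_sums \<alpha>"
      using that e[OF that(1,2)] by (auto simp: all_compositions_eq compositions_def split: if_splits)
    have "finite (partial_sums \<alpha>)" using partial_sums_subset[OF *(1)] by (rule finite_subset) simp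
    moreover have "partial_sums \<beta> = partial_sums \<alpha> \<Longrightarrow> \<beta> = \<alpha>"
      using inj_onD[OF partial_sums_inj _ *(2,1)] by blast
    ultimately show ?thesis using * by (metis psubset_card_mono psubsetI)
  qed
  note * = triangular_family_independent[of all_compositions e qs_F "\<lambda>\<alpha>. card (partial_sums \<alpha>)", OF lin]
  show "independent (qs_F ` all_compositions)" "inj_on qs_F all_compositions"
    by (rule *; use e tri in \<open>auto split: if_splits\<close>)+
qed

lemma qs_F_in_QSym: "qs_F \<alpha> \<in> QSym"
  unfolding qs_F_def by (intro subspace_sum subspace_QSym qs_M_in_QSym) (auto simp: all_compositions_def)

text \<open>Inverting the triangular system: \<open>M_\<alpha>\<close> is \<open>F_\<alpha>\<close>
  minus the \<open>M_\<beta>\<close> with \<open>\<beta>\<close> strictly finer, which have more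
  partial sums.\<close>

lemma QSym_eq_span_qs_F: "QSym = span (qs_F ` all_compositions)"
proof
  have "qs_M \<alpha> \<in> span (qs_F ` all_compositions)" if "\<alpha> \<in> compositions n" for \<alpha> n
    using that
  proof (induction "n - card (partial_sums \<alpha>)" arbitrary: \<alpha> rule: less_induct)
    case less
    let ?B = "{\<beta>. \<beta> \<in> compositions n \<and> comp_le \<alpha> \<beta>}"
    have n: "sum_list \<alpha> = n" using less.prems by (simp add: compositions_def)
    have \<alpha>: "\<alpha> \<in> ?B" using less.prems by (simp add: comp_le_def)
    have "qs_M \<beta> \<in> span (qs_F ` all_compositions)" if "\<beta> \<in> ?B - {\<alpha>}" for \<beta>
    proof (rule less.hyps)
      show "\<beta> \<in> compositions n" using that by auto
      have "partial_sums \<alpha> \<subset> partial_sums \<beta>"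
        using that inj_onD[OF partial_sums_inj, of \<alpha> \<beta> n] less.prems by (auto simp: comp_le_def)
      moreover have fin: "partial_sums \<beta> \<subseteq> {1..<n}" using that partial_sums_subset[of \<beta> n] by simp
      ultimately have "card (partial_sums \<alpha>) < card (partial_sums \<beta>)"
        by (meson finite_atLeastLessThan finite_subset psubset_card_mono)
      moreover have "card (partial_sums \<beta>) \<le> n - 1" using card_mono[OF _ fin] by simp
      ultimately show "n - card (partial_sums \<beta>) < n - card (partial_sums \<alpha>)" by simp
    qed
    then have "(\<Sum>\<beta>\<in>?B - {\<alpha>}. qs_M \<beta>) \<in> span (qs_F ` all_compositions)" by (rule span_sum)
    moreover have "qs_F \<alpha> \<in> span (qs_F ` all_compositions)"
      using less.prems by (auto simp: all_compositions_def intro: span_base)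
    moreover have "qs_M \<alpha> = qs_F \<alpha> - (\<Sum>\<beta>\<in>?B - {\<alpha>}. qs_M \<beta>)"
      unfolding qs_F_def n using \<alpha> finite_compositions by (simp add: sum.remove)
    ultimately show ?case by (metis span_diff)
  qed
  then show "QSym \<subseteq> span (qs_F ` all_compositions)"
    unfolding QSym_eq by (intro span_minimal) (auto simp: all_compositions_def)
  show "span (qs_F ` all_compositions) \<subseteq> QSym"
    by (intro span_minimal subspace_QSym) (auto simp: qs_F_in_QSym)
qed

text \<open>The power of degree \<open>n\<close> of the variable with index 0 has type
  \<open>one_part n\<close>, with no partial sums. Hence it occurs in \<open>F_\<beta>\<close> only
  for \<open>\<beta> = one_part n\<close>, and its coefficient isolates the wanted one.\<close>

lemma F_coeff_one_part:
  assumes "\<Phi> (qs_F \<alpha>) \<in> QSym"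
  shows "F_coeff \<Phi> \<alpha> (one_part n) = mcoeff (\<Phi> (qs_F \<alpha>)) (replicate_mset n 0)"
proof -
  let ?B = "qs_F ` all_compositions" and ?m = "replicate_mset n (0::nat)"
  define c where "c = representation ?B (\<Phi> (qs_F \<alpha>))"
  have one: "one_part n \<in> all_compositions"
    using one_part_in_compositions by (auto simp: all_compositions_def)
  have coeff: "mcoeff b ?m = of_bool (b = qs_F (one_part n))" if b: "b \<in> ?B" for b
  proof -
    obtain \<beta> where "b = qs_F \<beta>" "\<beta> \<in> all_compositions"
      using b by blast
    then obtain k where \<beta>: "b = qs_F \<beta>" "\<beta> \<in> compositions k" "\<beta> \<in> all_compositions"
      unfolding all_compositions_def by blast
    have "n = k \<and> partial_sums \<beta> = {} \<longleftrightarrow> \<beta> = one_part n"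
    proof
      assume "n = k \<and> partial_sums \<beta> = {}"
      then show "\<beta> = one_part n"
        using inj_onD[OF partial_sums_inj _ \<beta>(2) one_part_in_compositions[of k]] by simp
    qed (use \<beta>(2) one_part_in_compositions[of n] in \<open>auto simp: compositions_def\<close>)
    moreover have "b = qs_F (one_part n) \<longleftrightarrow> \<beta> = one_part n"
      using \<beta> one by (auto dest: inj_onD[OF qs_F_inj])
    ultimately show ?thesis using \<beta> by (simp add: mcoeff_qs_F exponents_replicate)
  qed
  have fin: "finite {b. c b \<noteq> 0}" unfolding c_def by (rule finite_representation)
  have in_B: "b \<in> ?B" if "c b \<noteq> 0" for b using that unfolding c_def by (rule representation_ne_zero)
  have "mcoeff (\<Phi> (qs_F \<alpha>)) ?m = mcoeff (\<Sum>b | c b \<noteq> 0. c b *\<^sub>R b) ?m"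
    unfolding c_def using assms
    by (subst sum_nonzero_representation_eq[OF qs_F_independent]) (auto simp: QSym_eq_span_qs_F)
  also have "\<dots> = (\<Sum>b | c b \<noteq> 0. if b = qs_F (one_part n) then c b else 0)"
    unfolding mcoeff_sum by (rule sum.cong) (auto simp: coeff in_B)
  also have "\<dots> = c (qs_F (one_part n))" using fin by simp
  finally show ?thesis by (simp add: F_coeff_def c_def)
qed


section \<open>Stable sorting\<close>

text \<open>The sorted word of \<open>m\<close> consists of runs of equal letters with lengths
  \<open>exponents m\<close>, so it ascends strictly just after the partial sums. Lists start at 0,
  so position \<open>k\<close> separates \<open>u ! (k - 1)\<close> from
  \<open>u ! k\<close>.\<close>

lemma ex_sorted_word:
  "\<exists>u. mset u = m \<and> sorted u \<and>
    (\<forall>k. 1 \<le> k \<and> k < size m \<longrightarrow> (k \<in> partial_sums (exponents m) \<longleftrightarrow> u ! (k - 1) < u ! k))"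
proof (induction "exponents m" arbitrary: m)
  case Nil
  then show ?case by (intro exI[of _ "[]"]) (metis exponents_eq_Nil_iff mset.simps(1) not_less_zero
    size_empty sorted0)
next
  case (Cons a \<alpha>)
  have a: "a > 0" using exponents_nonzero[of m] Cons.hyps(2)[symmetric] by auto
  define x where "x = Min (set_mset m)"
  define m' where "m' = m - replicate_mset a x"
  have "m \<noteq> {#}" and count: "count m x = a" and \<alpha>: "\<alpha> = exponents m'"
    using Cons.hyps(2)[symmetric] a by (auto simp: exponents_eq_Cons_iff x_def m'_def)
  obtain v where v: "mset v = m'" "sorted v"
    "\<And>k. 1 \<le> k \<Longrightarrow> k < size m' \<Longrightarrow> k \<in> partial_sums \<alpha> \<longleftrightarrow> v ! (k - 1) < v ! k"
    using Cons.hyps(1)[OF \<alpha>] unfolding \<alpha> by blast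
  have m: "m = replicate_mset a x + m'"
    unfolding m'_def using count by (simp add: count_le_replicate_mset_subset_eq[symmetric])
  have "x \<notin># m'" using count unfolding m by (simp add: not_in_iff)
  moreover have "\<And>y. y \<in># m \<Longrightarrow> x \<le> y" by (simp add: x_def)
  ultimately have less: "x < y" if "y \<in> set v" for y
    using that v(1) m by (metis order.not_eq_order_implies_strict set_mset_mset union_iff)
  let ?u = "replicate a x @ v"
  have "k \<in> partial_sums (a # \<alpha>) \<longleftrightarrow> ?u ! (k - 1) < ?u ! k" if k: "1 \<le> k" "k < size m" for k
  proof -
    have "\<alpha> \<in> compositions (size m')" unfolding \<alpha> by (rule exponents_in_compositions)
    note pos = partial_sums_subset[OF this]
    have len: "length v = size m'" using v(1) by auto
    have size_m: "size m = a + size m'" using m by simp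
    \<comment> \<open>Inside the first run, at its end, or beyond it.\<close>
    consider "k < a" | "k = a" | "a < k" by linarith
    then show ?thesis
    proof cases
      case 1
      then have "k \<notin> partial_sums (a # \<alpha>)"
        by (cases "\<alpha> = []") (auto simp: partial_sums_Cons)
      moreover have "k - 1 < a" using 1 by simp
      ultimately show ?thesis using 1 by (simp add: nth_append)
    next
      case 2
      then have "m' \<noteq> {#}" using k size_m by auto
      then have "\<alpha> \<noteq> []" by (simp add: \<alpha>)
      moreover have "x < v ! 0" using \<open>m' \<noteq> {#}\<close> v(1) less by (metis length_greater_0_conv mset_zero_iff nth_mem)
      ultimately show ?thesis using 2 a by (simp add: nth_append partial_sums_Cons)
    next
      case 3
      then have "m' \<noteq> {#}" using k size_m by auto
      then have "\<alpha> \<noteq> []" by (simp add: \<alpha>)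
      then have "k \<in> partial_sums (a # \<alpha>) \<longleftrightarrow> k - a \<in> partial_sums \<alpha>"
        using 3 by (auto simp: partial_sums_Cons image_iff intro!: bexI[of _ "k - a"])
      also have "\<dots> \<longleftrightarrow> v ! (k - a - 1) < v ! (k - a)"
        using 3 k size_m by (intro v(3)) auto
      moreover have "\<not> k - 1 < a" "k - 1 - a = k - a - 1" using 3 by auto
      ultimately show ?thesis using 3 by (simp add: nth_append)
    qed
  qed
  moreover have "sorted ?u" using v(2) less by (auto simp: sorted_append intro: less_imp_le)
  moreover have "mset ?u = m" using v(1) m by simp
  ultimately show ?case unfolding Cons.hyps(2)[symmetric] by blast
qed

lemma sorted_map_upt_iff:
  "sorted_wrt R (map f [1..<Suc n]) \<longleftrightarrow> (\<forall>i j. 1 \<le> i \<and> i < j \<and> j \<le> n \<longrightarrow> R (f i) (f j))"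
proof -
  have "R (f i) (f j)" if "\<forall>i j. i < j \<longrightarrow> j < n \<longrightarrow> R (f (Suc i)) (f (Suc j))" "1 \<le> i" "i < j" "j \<le> n" for i j
    using that(1)[rule_format, of "i - 1" "j - 1"] that(2-) by auto
  then show ?thesis
    by (auto simp: sorted_wrt_iff_nth_less simp del: upt_Suc)
qed

text \<open>A word \<open>w\<close> with content \<open>u\<close> corresponds to the permutation \<open>\<sigma>\<close> that sorts it stably, so that
  \<open>w \<circ> \<sigma> = u\<close>. Stability is expressed by sorting positions \<open>x\<close> by the injective key
  \<open>w x * (n + 1) + x\<close>.\<close>

lemma card_permutations_descents_subset:
  fixes u :: "nat list"
  assumes u: "sorted u" "length u = n"
    and S: "\<And>k. 1 \<le> k \<Longrightarrow> k < n \<Longrightarrow> k \<in> S \<longleftrightarrow> u ! (k - 1) < u ! k"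
  shows "card {\<sigma>. \<sigma> permutes {1..n} \<and> descents n \<sigma> \<subseteq> S} = card {w. mset w = mset u}"
proof (rule bij_betw_same_card)
  let ?A = "{\<sigma>. \<sigma> permutes {1..n} \<and> descents n \<sigma> \<subseteq> S}"
  \<comment> \<open>The word \<open>u \<circ> inv \<sigma>\<close>, with positions
    \<open>1..n\<close> shifted to list indices.\<close>
  define F where "F = (\<lambda>\<sigma>. map (\<lambda>x. u ! (inv \<sigma> x - 1)) [1..<Suc n])"
  \<comment> \<open>Positions are at most \<open>n\<close>, so modulo \<open>n + 1\<close> the key
    returns the position, and division returns the letter.\<close>
  define key where "key = (\<lambda>w x. w ! (x - 1) * (n + 1) + x)" for w :: "nat list"
  have key_mod: "key w x mod (n + 1) = x" and key_div: "key w x div (n + 1) = w ! (x - 1)"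
    if "x \<in> {1..n}" for w x
    unfolding key_def mod_mult_self3 using that by (simp_all add: div_mult_self3 del: mult_Suc_right)
  have F_nth: "F \<sigma> ! (\<sigma> k - 1) = u ! (k - 1)" if "\<sigma> permutes {1..n}" "k \<in> {1..n}" for \<sigma> k
  proof -
    have "\<sigma> k \<in> {1..n}" using that by (simp add: permutes_in_image del: atLeastAtMost_iff)
    then have "[1..<Suc n] ! (\<sigma> k - 1) = \<sigma> k" by (subst nth_upt) auto
    then show ?thesis using \<open>\<sigma> k \<in> {1..n}\<close> permutes_inverses(2)[OF that(1)]
      unfolding F_def by (subst nth_map) auto
  qed
  have sorted_key: "sorted_wrt (<) (map (\<lambda>k. key (F \<sigma>) (\<sigma> k)) [1..<Suc n])" if \<sigma>: "\<sigma> \<in> ?A" for \<sigma>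
    unfolding sorted_map_upt_iff
  proof (intro allI impI)
    \<comment> \<open>At \<open>k \<in> S\<close> the letter grows strictly, which outweighs any
      change of position; elsewhere the letter stays the same, and \<open>k\<close> is not a
      descent, so the position grows.\<close>
    have step: "key (F \<sigma>) (\<sigma> k) < key (F \<sigma>) (\<sigma> (Suc k))" if k: "1 \<le> k" "k < n" for k
    proof -
      have in_range: "\<sigma> k \<in> {1..n}" "\<sigma> (Suc k) \<in> {1..n}"
        using \<sigma> k by (simp_all add: permutes_in_image del: atLeastAtMost_iff) auto
      have eq: "F \<sigma> ! (\<sigma> k - 1) = u ! (k - 1)" "F \<sigma> ! (\<sigma> (Suc k) - 1) = u ! k"
        using \<sigma> k F_nth[of \<sigma> k] F_nth[of \<sigma> "Suc k"] by auto
      show ?thesis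
      proof (cases "k \<in> S")
        case True
        then have "Suc (u ! (k - 1)) \<le> u ! k" using S[OF k] by simp
        then have "Suc (u ! (k - 1)) * (n + 1) \<le> u ! k * (n + 1)" by (rule mult_le_mono1)
        then show ?thesis using in_range unfolding key_def eq by simp
      next
        case False
        have "u ! (k - 1) \<le> u ! k" using u k by (intro sorted_nth_mono) auto
        then have "u ! (k - 1) = u ! k" using S[OF k] False by simp
        moreover have "\<sigma> k \<noteq> \<sigma> (Suc k)"
          using \<sigma> by (metis (mono_tags) mem_Collect_eq n_not_Suc_n permutes_inj injD)
        then have "\<sigma> k < \<sigma> (Suc k)" using False \<sigma> k by (force simp: descents_def)
        ultimately show ?thesis unfolding key_def eq by simp
      qed
    qed
    fix i j assume "1 \<le> i \<and> i < j \<and> j \<le> n"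
    then have "i < j" "1 \<le> i" "j \<le> n" by auto
    then show "key (F \<sigma>) (\<sigma> i) < key (F \<sigma>) (\<sigma> j)"
    proof (induction i j rule: less_Suc_induct)
      case (1 i) then show ?case using step by auto
    next
      case (2 i j k) then show ?case by (meson le_trans less_imp_le_nat less_trans)
    qed
  qed
  show "bij_betw F ?A {w. mset w = mset u}"
  proof (rule bij_betw_imageI)
    show "inj_on F ?A"
    proof (rule inj_onI)
      fix \<sigma> \<tau> assume \<sigma>: "\<sigma> \<in> ?A" and \<tau>: "\<tau> \<in> ?A" and eq: "F \<sigma> = F \<tau>"
      have set: "set (map (\<lambda>k. key (F \<sigma>) (\<rho> k)) [1..<Suc n]) = key (F \<sigma>) ` {1..n}" if "\<rho> \<in> ?A" for \<rho>
        using that permutes_image[of \<rho> "{1..n}"]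
        by (simp add: image_image[symmetric, of "key (F \<sigma>)" \<rho>] atLeastLessThanSuc_atLeastAtMost del: upt_Suc)
      \<comment> \<open>Both lists enumerate the same set of keys in strictly increasing order, so
        they coincide.\<close>
      have "map (\<lambda>k. key (F \<sigma>) (\<sigma> k)) [1..<Suc n] = map (\<lambda>k. key (F \<sigma>) (\<tau> k)) [1..<Suc n]"
        using sorted_key[OF \<sigma>] sorted_key[OF \<tau>] set[OF \<sigma>] set[OF \<tau>] eq
        by (intro strict_sorted_equal) auto
      then have key_eq: "key (F \<sigma>) (\<sigma> k) = key (F \<sigma>) (\<tau> k)" if "k \<in> {1..n}" for k
        using that by (auto simp del: upt_Suc)
      show "\<sigma> = \<tau>"
      proof
        fix k
        show "\<sigma> k = \<tau> k"
        proof (cases "k \<in> {1..n}")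
          case True
          then have "\<sigma> k \<in> {1..n}" "\<tau> k \<in> {1..n}"
            using \<sigma> \<tau> by (simp_all add: permutes_in_image del: atLeastAtMost_iff)
          then show ?thesis using key_eq[OF True] key_mod by metis
        qed (use \<sigma> \<tau> in \<open>auto simp: permutes_def\<close>)
      qed
    qed
    show "F ` ?A = {w. mset w = mset u}"
    proof (intro equalityI subsetI)
      fix w assume "w \<in> F ` ?A"
      then obtain \<sigma> where \<sigma>: "\<sigma> permutes {1..n}" "w = F \<sigma>" by auto
      have "mset w = image_mset (\<lambda>x. u ! (inv \<sigma> x - 1)) (mset_set {1..n})"
        by (simp only: \<sigma> F_def mset_map mset_upt atLeastLessThanSuc_atLeastAtMost)
      also have "\<dots> = image_mset (\<lambda>x. u ! (x - 1)) (image_mset (inv \<sigma>) (mset_set {1..n}))"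
        by (simp add: multiset.map_comp comp_def)
      also have "image_mset (inv \<sigma>) (mset_set {1..n}) = mset_set {1..n}"
        using \<sigma> by (intro permutes_image_mset permutes_inv)
      also have "image_mset (\<lambda>x. u ! (x - 1)) (mset_set {1..n}) = mset (map (\<lambda>x. u ! (x - 1)) [1..<Suc n])"
        by (simp only: mset_map mset_upt atLeastLessThanSuc_atLeastAtMost)
      also have "map (\<lambda>x. u ! (x - 1)) [1..<Suc n] = u"
        using u by (intro nth_equalityI) (auto simp del: upt_Suc)
      finally show "w \<in> {w. mset w = mset u}" by simp
    next
      fix w assume "w \<in> {w. mset w = mset u}"
      then have w: "mset w = mset u" "length w = n" using u mset_eq_length by auto
      define L where "L = sorted_list_of_set (key w ` {1..n})"
      have inj: "inj_on (key w) {1..n}" by (rule inj_on_inverseI[where g = "\<lambda>y. y mod (n + 1)"]) (rule key_mod)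
      have L: "set L = key w ` {1..n}" "length L = n" "sorted_wrt (<) L" "distinct L"
        using card_image[OF inj] by (simp_all add: L_def)
      \<comment> \<open>\<open>\<sigma>\<close> lists the positions of \<open>w\<close> in the order
        of their keys and fixes everything outside \<open>{1..n}\<close>.\<close>
      define \<sigma> where "\<sigma> k = (if k \<in> {1..n} then L ! (k - 1) mod (n + 1) else k)" for k
      have L_key: "L ! (k - 1) = key w (\<sigma> k)" "\<sigma> k \<in> {1..n}" if "k \<in> {1..n}" for k
      proof -
        have "L ! (k - 1) \<in> key w ` {1..n}" using that L by (metis atLeastAtMost_iff diff_less le_trans
          less_le_trans nth_mem zero_less_one)
        then obtain x where "x \<in> {1..n}" "L ! (k - 1) = key w x" by blast
        moreover from this have "\<sigma> k = x" using that key_mod[of x w] by (simp add: \<sigma>_def)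
        ultimately show "L ! (k - 1) = key w (\<sigma> k)" "\<sigma> k \<in> {1..n}" by auto
      qed
      have "inj_on \<sigma> {1..n}"
      proof (rule inj_onI)
        fix k l assume kl: "k \<in> {1..n}" "l \<in> {1..n}" "\<sigma> k = \<sigma> l"
        then have "L ! (k - 1) = L ! (l - 1)" by (simp only: L_key(1))
        then have "k - 1 = l - 1" using kl L by (subst (asm) nth_eq_iff_index_eq) auto
        then show "k = l" using kl by auto
      qed
      moreover have "\<sigma> ` {1..n} \<subseteq> {1..n}" using L_key(2) by blast
      ultimately have "bij_betw \<sigma> {1..n} {1..n}" by (simp add: bij_betw_def endo_inj_surj)
      then have \<sigma>: "\<sigma> permutes {1..n}" by (rule bij_imp_permutes) (auto simp: \<sigma>_def)
      have "map (\<lambda>y. y div (n + 1)) L = u"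
      proof -
        have "sorted (map (\<lambda>y. y div (n + 1)) L)"
          using L(3) by (auto simp: sorted_wrt_map strict_sorted_iff intro!: sorted_wrt_mono_rel[OF _ L(3)] div_le_mono)
        moreover have "mset (map (\<lambda>y. y div (n + 1)) L) = mset u"
        proof -
          have "mset L = image_mset (key w) (mset_set {1..n})"
            using L(1,4) by (metis image_mset_mset_set inj mset_set_set)
          then have "mset (map (\<lambda>y. y div (n + 1)) L) =
              image_mset (\<lambda>x. w ! (x - 1)) (mset_set {1..n})"
            using key_div by (auto simp: multiset.map_comp comp_def intro!: image_mset_cong)
          also have "\<dots> = mset (map (\<lambda>x. w ! (x - 1)) [1..<Suc n])"
            by (simp only: mset_map mset_upt atLeastLessThanSuc_atLeastAtMost)
          also have "map (\<lambda>x. w ! (x - 1)) [1..<Suc n] = w"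
            using w by (intro nth_equalityI) (auto simp del: upt_Suc)
          finally show ?thesis using w by simp
        qed
        ultimately show ?thesis using u(1) by (metis properties_for_sort)
      qed
      then have u_nth: "u ! (k - 1) = w ! (\<sigma> k - 1)" if "k \<in> {1..n}" for k
        using L_key[OF that] key_div[of "\<sigma> k" w] L(2) that by (metis One_nat_def Suc_le_eq atLeastAtMost_iff
          diff_less le_less_trans less_le_trans nth_map zero_less_one less_imp_le_nat Suc_pred)
      \<comment> \<open>At a descent the position drops while the key grows, so the letter must grow
        strictly.\<close>
      have "descents n \<sigma> \<subseteq> S"
      proof
        fix k assume "k \<in> descents n \<sigma>"
        then have k: "1 \<le> k" "k < n" "\<sigma> (Suc k) < \<sigma> k" by (auto simp: descents_def)
        have "L ! (k - 1) < L ! k" using sorted_wrt_nth_less[OF L(3), of "k - 1" k] L(2) k by simp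
        then have "key w (\<sigma> k) < key w (\<sigma> (Suc k))" using L_key(1)[of k] L_key(1)[of "Suc k"] k by auto
        then have "w ! (\<sigma> k - 1) * (n + 1) < w ! (\<sigma> (Suc k) - 1) * (n + 1)" using k by (simp add: key_def)
        then have "w ! (\<sigma> k - 1) < w ! (\<sigma> (Suc k) - 1)" by (rule mult_less_cancel2[THEN iffD1, THEN conjunct2])
        then show "k \<in> S" using S k u_nth[of k] u_nth[of "Suc k"] by auto
      qed
      moreover have "F \<sigma> = w"
      proof (rule nth_equalityI)
        fix i assume "i < length (F \<sigma>)"
        then have i: "i < n" by (simp add: F_def del: upt_Suc)
        define k where "k = inv \<sigma> (Suc i)"
        have "\<sigma> k = Suc i" using permutes_inverses(1)[OF \<sigma>] by (simp add: k_def)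
        moreover have "k \<in> {1..n}" using i \<sigma> unfolding k_def
          by (subst permutes_in_image[OF permutes_inv]) auto
        ultimately show "F \<sigma> ! i = w ! i" using F_nth[OF \<sigma>, of k] u_nth[of k] by simp
      qed (simp add: F_def w del: upt_Suc)
      ultimately show "w \<in> F ` ?A" using \<sigma> by blast
    qed
  qed
qed


section \<open>Probabilities on the symmetric group\<close>

lemma sum_prod_list_words:
  fixes x :: "'a \<Rightarrow> 'b::comm_semiring_1"
  assumes "finite A"
  shows "(\<Sum>w | set w \<subseteq> A \<and> length w = n. \<Prod>i\<leftarrow>w. x i) = (\<Sum>i\<in>A. x i) ^ n"
proof (induction n)
  case 0
  have "{w. set w \<subseteq> A \<and> length w = 0} = {[]}" by auto
  then show ?case by simp
next
  case (Suc n)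
  have "(\<Sum>w | set w \<subseteq> A \<and> length w = Suc n. \<Prod>i\<leftarrow>w. x i) =
      (\<Sum>(i, w)\<in>A \<times> {w. set w \<subseteq> A \<and> length w = n}. x i * (\<Prod>i\<leftarrow>w. x i))"
    by (rule sum.reindex_bij_witness[of _ "\<lambda>(i, w). i # w" "\<lambda>w. (hd w, tl w)"])
      (auto simp: length_Suc_conv)
  also have "\<dots> = (\<Sum>i\<in>A. x i) * (\<Sum>w | set w \<subseteq> A \<and> length w = n. \<Prod>i\<leftarrow>w. x i)"
    by (simp add: sum_product sum.cartesian_product)
  finally show ?case by (simp add: Suc.IH)
qed

lemma sum_words_by_content:
  fixes x :: "nat \<Rightarrow> real"
  shows "(\<Sum>m\<in>homogeneous_monomials n N. real (card {w. mset w = m}) * (\<Prod>i\<in>#m. x i)) =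
    (\<Sum>i<N. x i) ^ n"
proof -
  let ?W = "{w. set w \<subseteq> {..<N} \<and> length w = n}"
  have W: "finite ?W" by (rule finite_lists_length_eq) simp
  have "(\<Sum>i<N. x i) ^ n = (\<Sum>w\<in>?W. \<Prod>i\<leftarrow>w. x i)" by (simp add: sum_prod_list_words)
  also have "\<dots> = (\<Sum>m\<in>homogeneous_monomials n N. \<Sum>w\<in>{w \<in> ?W. mset w = m}. \<Prod>i\<leftarrow>w. x i)"
    by (rule sum.group[symmetric, OF W finite_homogeneous_monomials])
      (auto simp: homogeneous_monomials_def)
  also have "\<dots> = (\<Sum>m\<in>homogeneous_monomials n N. real (card {w. mset w = m}) * (\<Prod>i\<in>#m. x i))"
  proof (rule sum.cong[OF refl])
    fix m assume "m \<in> homogeneous_monomials n N"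
    then have "{w \<in> ?W. mset w = m} = {w. mset w = m}" by (auto simp: homogeneous_monomials_def)
    moreover have "(\<Prod>i\<leftarrow>w. x i) = (\<Prod>i\<in>#mset w. x i)" for w by (simp flip: prod_mset_prod_list)
    ultimately show "(\<Sum>w\<in>{w \<in> ?W. mset w = m}. \<Prod>i\<leftarrow>w. x i) =
        real (card {w. mset w = m}) * (\<Prod>i\<in>#m. x i)" by simp
  qed
  finally show ?thesis by simp
qed

text \<open>This is the identity \<open>\<Sum>\<sigma>. F_D(\<sigma>) = (x_1 + x_2 + ...)^n\<close>
  at the monomial \<open>m\<close>: the left side counts permutations with descents in a given set,
  the right side words with content \<open>m\<close>.\<close>

lemma sum_mcoeff_qs_F_descent_comp:
  assumes "size m = n"
  shows "(\<Sum>\<sigma> | \<sigma> permutes {1..n}. mcoeff (qs_F (descent_comp n \<sigma>)) m) = real (card {w. mset w = m})"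
proof -
  obtain u where u: "mset u = m" "sorted u"
    "\<And>k. 1 \<le> k \<Longrightarrow> k < n \<Longrightarrow> k \<in> partial_sums (exponents m) \<longleftrightarrow> u ! (k - 1) < u ! k"
    using ex_sorted_word[of m] assms by blast
  then have len: "length u = n" using assms by auto
  have "(\<Sum>\<sigma> | \<sigma> permutes {1..n}. mcoeff (qs_F (descent_comp n \<sigma>)) m) =
      (\<Sum>\<sigma> | \<sigma> permutes {1..n}. of_bool (descents n \<sigma> \<subseteq> partial_sums (exponents m)))"
    using assms by (simp add: mcoeff_qs_F[OF descent_comp_properties(1)] descent_comp_properties(2))
  also have "\<dots> = real (card {\<sigma>. \<sigma> permutes {1..n} \<and> descents n \<sigma> \<subseteq> partial_sums (exponents m)})"
    by (simp add: finite_permutations Int_def sum_of_bool_eq)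
  also have "\<dots> = real (card {w. mset w = mset u})"
    using card_permutations_descents_subset[OF u(2) len u(3)] by simp
  finally show ?thesis by (simp add: u(1))
qed

text \<open>Each finite subset of \<open>S\<close> lies in some \<open>A N\<close>, so
  \<open>L\<close> bounds all finite sums and gives summability. The \<open>A N\<close> are cofinal
  among the finite subsets, which identifies the sum.\<close>

lemma has_sum_exhaustion:
  fixes g :: "'a \<Rightarrow> real"
  assumes "\<And>x. x \<in> S \<Longrightarrow> g x \<ge> 0" and fin: "\<And>N. finite (A N)" and A: "\<And>N. A N \<subseteq> A (Suc N)"
    and S: "(\<Union>N. A N) = S" and lim: "(\<lambda>N. sum g (A N)) \<longlonglongrightarrow> L"
  shows "(g has_sum L) S"
proof -
  have mono: "A M \<subseteq> A N" if "M \<le> N" for M N using that A lift_Suc_mono_le by metis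
  have AS: "A N \<subseteq> S" for N using S by blast
  have "incseq (\<lambda>N. sum g (A N))"
    using assms(1) AS by (intro incseq_SucI sum_mono2 fin A) blast
  then have le: "sum g (A N) \<le> L" for N using lim by (rule incseq_le)
  have ev: "\<exists>N. F \<subseteq> A N" if "finite F" "F \<subseteq> S" for F
    using that
  proof (induction F)
    case (insert x F)
    then obtain N M where "F \<subseteq> A N" "x \<in> A M" using S by blast
    then show ?case using mono[of N "max M N"] mono[of M "max M N"] by (intro exI[of _ "max M N"]) auto
  qed simp
  have "g summable_on S"
  proof (rule nonneg_bdd_above_summable_on)
    show "bdd_above (sum g ` {F. F \<subseteq> S \<and> finite F})"
    proof (rule bdd_aboveI2)
      fix F assume "F \<in> {F. F \<subseteq> S \<and> finite F}"
      then obtain N where "F \<subseteq> A N" using ev by blast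
      then have "sum g F \<le> sum g (A N)" using assms(1) AS by (intro sum_mono2 fin) blast+
      then show "sum g F \<le> L" using le[of N] by linarith
    qed
  qed (rule assms(1))
  then have "(sum g \<longlongrightarrow> infsum g S) (finite_subsets_at_top S)"
    using has_sum_infsum has_sum_def by blast
  moreover have "filterlim A (finite_subsets_at_top S) sequentially"
    unfolding filterlim_def le_filter_def eventually_filtermap eventually_finite_subsets_at_top
      eventually_sequentially
    by (meson AS fin ev mono subset_trans)
  ultimately have "(\<lambda>N. sum g (A N)) \<longlonglongrightarrow> infsum g S"
    by (rule filterlim_compose)
  then have "L = infsum g S" using lim LIMSEQ_unique by blast
  with \<open>g summable_on S\<close> show ?thesis by (simp add: has_sum_infsum)
qed

lemma prod_mset_nonneg:
  fixes r :: "'a \<Rightarrow> real"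
  shows "(\<And>i. r i \<ge> 0) \<Longrightarrow> (\<Prod>i\<in>#m. r i) \<ge> 0"
  by (induction m) auto

text \<open>Reduces the infinite sum in \<open>mseries_eval\<close> to a limit of evaluations in
  finitely many variables, the form in which the endomorphism is given.\<close>

lemma mseries_eval_eqI:
  assumes nonneg: "\<And>m. mcoeff f m \<ge> 0" "\<And>i. r i \<ge> 0"
    and hom: "\<And>m. size m \<noteq> n \<Longrightarrow> mcoeff f m = 0"
    and lim: "(\<lambda>N. \<Sum>m\<in>homogeneous_monomials n (Suc N). mcoeff f m * (\<Prod>i\<in>#m. r i)) \<longlonglongrightarrow> L"
  shows "mseries_eval f r = L"
proof -
  let ?g = "\<lambda>m. mcoeff f m * (\<Prod>i\<in>#m. r i)"
  have "(?g has_sum L) {m. size m = n}"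
  proof (rule has_sum_exhaustion[OF _ _ _ _ lim])
    show "?g m \<ge> 0" for m
      using nonneg by (intro mult_nonneg_nonneg prod_mset_nonneg) auto
    show "(\<Union>N. homogeneous_monomials n (Suc N)) = {m. size m = n}"
    proof (intro equalityI subsetI)
      fix m :: "nat multiset" assume "m \<in> {m. size m = n}"
      moreover obtain N where "set_mset m \<subseteq> {..<N}" using finite_nat_iff_bounded by blast
      ultimately have "m \<in> homogeneous_monomials n (Suc N)"
        by (auto simp: homogeneous_monomials_def intro: less_SucI)
      then show "m \<in> (\<Union>N. homogeneous_monomials n (Suc N))" by blast
    qed (auto simp: homogeneous_monomials_def)
    show "finite (homogeneous_monomials n (Suc N))" for N by (rule finite_homogeneous_monomials)
    show "homogeneous_monomials n (Suc N) \<subseteq> homogeneous_monomials n (Suc (Suc N))" for N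
      by (auto simp: homogeneous_monomials_def)
  qed
  then have "infsum ?g {m. size m = n} = L" by (rule infsumI)
  moreover have "infsum ?g UNIV = infsum ?g {m. size m = n}"
    by (rule infsum_cong_neutral) (auto simp: hom)
  ultimately show ?thesis by (simp add: mseries_eval_def)
qed

section \<open>Probabilities attached to the endomorphism\<close>

context probability_sequence
begin

text \<open>\<open>k div Suc N = 0\<close> means \<open>k < Suc N\<close>, and then
  \<open>k mod Suc N = k\<close>; so in the truncated image this coefficient is
  \<open>F_\<alpha>\<close> at the first \<open>Suc N\<close> terms of \<open>r\<close>.\<close>

lemma mcoeff_specialisation_endo_one_part:
  "(\<lambda>N. \<Sum>m\<in>homogeneous_monomials n (Suc N). mcoeff (qs_F \<alpha>) m * (\<Prod>i\<in>#m. r i))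
    \<longlonglongrightarrow> mcoeff (specialisation_endo r (qs_F \<alpha>)) (replicate_mset n 0)"
proof -
  have eq: "{M. image_mset (\<lambda>k. k div Suc N) M = replicate_mset n 0} = homogeneous_monomials n (Suc N)"
    for N
  proof -
    have "image_mset (\<lambda>k. k div Suc N) M = replicate_mset n 0 \<longleftrightarrow> M \<in> homogeneous_monomials n (Suc N)" for M
    proof -
      have "image_mset (\<lambda>k. k div Suc N) M = replicate_mset n 0 \<longleftrightarrow>
          size M = n \<and> (\<forall>x\<in>#M. x div Suc N = 0)"
      proof
        assume *: "image_mset (\<lambda>k. k div Suc N) M = replicate_mset n 0"
        have "size M = n" using arg_cong[OF *, of size] by simp
        moreover have "x div Suc N = 0" if "x \<in># M" for x
        proof -
          have "x div Suc N \<in># replicate_mset n 0" using that unfolding *[symmetric] by auto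
          then show ?thesis by (simp split: if_splits)
        qed
        ultimately show "size M = n \<and> (\<forall>x\<in>#M. x div Suc N = 0)" by blast
      next
        assume *: "size M = n \<and> (\<forall>x\<in>#M. x div Suc N = 0)"
        then have "image_mset (\<lambda>k. k div Suc N) M = image_mset (\<lambda>_. 0) M"
          by (intro image_mset_cong) auto
        then show "image_mset (\<lambda>k. k div Suc N) M = replicate_mset n 0"
          using * by (simp add: image_mset_const_eq)
      qed
      then show ?thesis by (auto simp: homogeneous_monomials_def div_eq_0_iff)
    qed
    then show ?thesis by blast
  qed
  have "(\<Prod>i\<in>#m. r (i mod Suc N)) = (\<Prod>i\<in>#m. r i)" if "m \<in> homogeneous_monomials n (Suc N)" for m N
    using that by (intro arg_cong[where f = prod_mset] image_mset_cong)
      (auto simp: homogeneous_monomials_def)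
  then have "mcoeff (block_subst r N (qs_F \<alpha>)) (replicate_mset n 0) =
      (\<Sum>m\<in>homogeneous_monomials n (Suc N). mcoeff (qs_F \<alpha>) m * (\<Prod>i\<in>#m. r i))" for N
    by (simp add: block_subst_def mcoeff_msubst eq)
  with block_subst_tendsto[OF qs_F_in_QSym, of \<alpha> "replicate_mset n 0"] show ?thesis by simp
qed

lemma mseries_eval_qs_F:
  assumes "\<alpha> \<in> compositions n"
  shows "mseries_eval (qs_F \<alpha>) r = mcoeff (specialisation_endo r (qs_F \<alpha>)) (replicate_mset n 0)"
  by (rule mseries_eval_eqI[OF _ nonneg _ mcoeff_specialisation_endo_one_part])
    (use assms in \<open>auto simp: mcoeff_qs_F\<close>)

lemma mseries_eval_qs_F_nonneg:
  assumes "\<alpha> \<in> compositions n"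
  shows "mseries_eval (qs_F \<alpha>) r \<ge> 0"
  unfolding mseries_eval_def using assms
  by (intro infsum_nonneg mult_nonneg_nonneg prod_mset_nonneg) (auto simp: mcoeff_qs_F nonneg)

lemma F_coeff_specialisation_endo:
  assumes "\<alpha> \<in> compositions n"
  shows "F_coeff (specialisation_endo r) \<alpha> (one_part n) = mseries_eval (qs_F \<alpha>) r"
proof -
  have "specialisation_endo r (qs_F \<alpha>) \<in> QSym"
  proof -
    have "qs_F \<alpha> \<in> QSym_deg n"
      using assms unfolding qs_F_def QSym_deg_def
      by (intro span_sum span_base) (auto simp: compositions_def)
    then have "specialisation_endo r (qs_F \<alpha>) \<in> QSym_deg n"
      using specialisation_endo_hopf unfolding hopf_endomorphisms_def by blast
    then show ?thesis unfolding QSym_def by (intro span_base) blast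
  qed
  then show ?thesis by (simp add: F_coeff_one_part mseries_eval_qs_F[OF assms])
qed

text \<open>After truncation the sum is the \<open>n\<close>-th power of a partial sum of
  \<open>r\<close>, by counting words; these powers tend to 1. It is the denominator in
  \<open>prob_endo\<close>.\<close>

lemma sum_mseries_eval_descent_comp:
  "(\<Sum>\<sigma> | \<sigma> permutes {1..n}. mseries_eval (qs_F (descent_comp n \<sigma>)) r) = 1"
proof -
  let ?S = "\<lambda>N. \<Sum>\<sigma> | \<sigma> permutes {1..n}. \<Sum>m\<in>homogeneous_monomials n (Suc N).
    mcoeff (qs_F (descent_comp n \<sigma>)) m * (\<Prod>i\<in>#m. r i)"
  have "?S \<longlonglongrightarrow> (\<Sum>\<sigma> | \<sigma> permutes {1..n}. mseries_eval (qs_F (descent_comp n \<sigma>)) r)"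
    unfolding mseries_eval_qs_F[OF descent_comp_properties(1)]
    by (intro tendsto_sum mcoeff_specialisation_endo_one_part)
  moreover have "?S N = (\<Sum>i<Suc N. r i) ^ n" for N
  proof -
    have "?S N = (\<Sum>m\<in>homogeneous_monomials n (Suc N).
        (\<Sum>\<sigma> | \<sigma> permutes {1..n}. mcoeff (qs_F (descent_comp n \<sigma>)) m) * (\<Prod>i\<in>#m. r i))"
      by (subst sum.swap) (simp add: sum_distrib_right)
    also have "\<dots> = (\<Sum>m\<in>homogeneous_monomials n (Suc N). real (card {w. mset w = m}) * (\<Prod>i\<in>#m. r i))"
      by (rule sum.cong[OF refl], subst sum_mcoeff_qs_F_descent_comp)
        (auto simp: homogeneous_monomials_def)
    finally show ?thesis by (simp add: sum_words_by_content del: sum.lessThan_Suc)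
  qed
  moreover have "(\<lambda>N. (\<Sum>i<Suc N. r i) ^ n) \<longlonglongrightarrow> 1 ^ n"
    by (intro tendsto_power LIMSEQ_Suc) (use sums_1 in \<open>simp add: sums_def\<close>)
  ultimately show ?thesis using LIMSEQ_unique by auto
qed

text \<open>The values are nonnegative and sum to 1 over the permutations, so one of them is
  nonzero.\<close>

lemma prob_defined_specialisation_endo: "prob_defined (specialisation_endo r) n"
proof -
  have "\<exists>\<sigma>\<in>{\<sigma>. \<sigma> permutes {1..n}}. mseries_eval (qs_F (descent_comp n \<sigma>)) r \<noteq> 0"
    using sum_mseries_eval_descent_comp[of n] by (metis (mono_tags, lifting) sum.neutral zero_neq_one)
  then show ?thesis
    using descent_comp_properties(1)[of n]
    by (auto simp: prob_defined_def F_coeff_specialisation_endo mseries_eval_qs_F_nonneg)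
qed

lemma prob_endo_specialisation_endo:
  "prob_endo (specialisation_endo r) n \<pi> = mseries_eval (qs_F (descent_comp n \<pi>)) r"
  unfolding prob_endo_def F_coeff_specialisation_endo[OF descent_comp_properties(1)]
    sum_mseries_eval_descent_comp by simp

end

theorem theorem6p1:
  fixes r :: "nat \<Rightarrow> real"
  assumes "\<And>i. r i \<ge> 0" and "r sums 1"
  shows "\<exists>\<Phi>\<in>hopf_endomorphisms. \<forall>n.
    prob_defined \<Phi> n \<and>
    (\<forall>\<pi>. \<pi> permutes {1..n} \<longrightarrow> prob_endo \<Phi> n \<pi> = prob_QS r n (inv \<pi>)) \<and>
    (\<forall>\<sigma> \<pi>. \<sigma> permutes {1..n} \<longrightarrow> \<pi> permutes {1..n} \<longrightarrow>
       K_matrix \<Phi> n \<pi> (\<sigma> \<circ> \<pi>) = prob_QS r n \<sigma>)"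
proof -
  interpret probability_sequence r by unfold_locales (use assms in auto)
  have prob: "prob_endo (specialisation_endo r) n \<pi> = prob_QS r n (inv \<pi>)" if "\<pi> permutes {1..n}" for n \<pi>
    using that by (simp add: prob_endo_specialisation_endo prob_QS_def permutes_inv_inv)
  \<comment> \<open>The entry at \<open>(\<pi>, \<sigma> \<circ> \<pi>)\<close> is the probability
    of \<open>inv \<sigma>\<close>, so the first identity is applied to
    \<open>inv \<sigma>\<close>.\<close>
  have "K_matrix (specialisation_endo r) n \<pi> (\<sigma> \<circ> \<pi>) = prob_QS r n \<sigma>"
    if "\<sigma> permutes {1..n}" "\<pi> permutes {1..n}" for n \<sigma> \<pi>
  proof -
    have "\<sigma> \<circ> \<pi> \<circ> inv \<pi> = \<sigma>" using that(2) by (simp add: comp_assoc permutes_inv_o)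
    then show ?thesis
      using that prob[OF permutes_inv[OF that(1)]] by (simp add: K_matrix_def permutes_inv_inv)
  qed
  then show ?thesis
    using specialisation_endo_hopf prob_defined_specialisation_endo prob by blast
qed

end
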